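(* Let $(\mathbf W_j^{(1),n},\mathbf W_j^{(2),n})_{j\in\mathbb Z}$ be known cell-averaged values at time $t^n$, and suppose the CFL condition $\frac{\Delta t}{\Delta x}\max(|\lambda_\ell|,|\lambda_r|)\le\frac12$ holds. Then the approximate-Riemann-solver scheme (defined in the context) is asymptotic preserving, in the following sense. (i) For every $\varepsilon>0$ it is consistent (in the usual finite-volume sense) with solutions of $$\partial_t\mathbf W^{(1)}+\partial_x\mathbf f^{(1)}(\mathbf W)=0,\qquad \partial_t\mathbf W^{(2)}+\partial_x\mathbf f^{(2)}(\mathbf W)=\tfrac1\varepsilon\mathbf R^{(2)}(\mathbf W).$$ (ii) In the limit $\varepsilon\to0$ (with $\Delta t$, $\Delta x$ and the data at time $t^n$ fixed) it converges to the stable and consistent HLL scheme for the equilibrium system $\partial_t\mathbf W^{(1)}+\partial_x\mathbf f^{(1)}(\mathbf W^{(1)},\mathbf Q(\mathbf W^{(1)}))=0$, that is, to $$\mathbf W_j^{(1),n+1}=\mathbf W_j^{(1),n}-\frac{\Delta t}{\Delta x}\left(\mathbf F^{HLL}_{j+1/2}-\mathbf F^{HLL}_{j-1/2}\right),$$ $$\mathbf F^{HLL}_{j+1/2}=\frac{\lambda_r\mathbf f_{eq}(\mathbf W_j^{(1),n})-\lambda_\ell\mathbf f_{eq}(\mathbf W_{j+1}^{(1),n})+\lambda_r\lambda_\ell\big(\mathbf W_{j+1}^{(1),n}-\mathbf W_j^{(1),n}\big)}{\lambda_r-\lambda_\ell},$$ where $\mathbf f_{eq}(\mathbf V):=\mathbf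 f^{(1)}(\mathbf V,\mathbf Q(\mathbf V))$.
   Context: Setting. $K\subset\mathbb R^n$ is a convex set of admissible states; the system $\partial_t \mathbf W+\partial_x\mathbf f(\mathbf W)=\frac1\varepsilon\mathbf R(\mathbf W)$, $\mathbf W(t,x)\in K$, is hyperbolic ($\mathbf f$ smooth, $\nabla\mathbf f(\mathbf W)$ diagonalizable over $\mathbb R$). There are linear maps $M_1:\mathbb R^n\to\mathbb R^k$ of rank $k$ and $M_2:\mathbb R^n\to\mathbb R^{n-k}$ of rank $n-k$ with $\begin{pmatrix}M_1\\ M_2\end{pmatrix}$ nonsingular and $M_1\mathbf R(\mathbf W)=0$ on $K$. Write $\mathbf W^{(i)}=M_i\mathbf W$, $\mathbf f^{(i)}=M_i\mathbf f$, $\mathbf R^{(i)}=M_i\mathbf R$, $\mathbf f^{(i)}(\mathbf W^{(1)},\mathbf W^{(2)})=\mathbf f^{(i)}(\mathbf W)$. The source term is $\mathbf R^{(2)}(\mathbf W)=\mathbf Q(\mathbf W^{(1)})-\mathbf W^{(2)}$ with $\mathbf Q:\mathbb R^k\to\mathbb R^{n-k}$ a (possibly nonlinear) smooth map, and one assumes $\nabla\mathbf f^{(2)}(\mathbf W)\,\mathbf R(\mathbf W)=0$ for $\mathbf W\in K$. For every $\mathbf W^{(1)}\in M_1K$ the equilibrium state with components $(\mathbf W^{(1)},\mathbf Q(\mathbf W^{(1)}))$ lies in $K$. Approximate-Riemann-solver scheme. Uniform mesh of size $\Delta x$, time step $\Delta t$, constant wave speeds $\lambda_\ell<0<\lambda_r$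 (chosen large enough in absolute value for robustness of the HLL-type solver). For each $j$ let $\mathbf W^R_{j+1/2}(t)$ and $\mathbf W^L_{j+1/2}(t)$ solve $\frac{d}{dt}\mathbf W=\frac1\varepsilon\mathbf R(\mathbf W)$ with $\mathbf W^R_{j+1/2}(0)=\mathbf W^n_{j+1}$, $\mathbf W^L_{j+1/2}(0)=\mathbf W^n_j$. The update is $$\mathbf W_j^{(1),n+1}=\mathbf W_j^{(1),n}-\tfrac{\Delta t}{\Delta x}\big(\mathbf F^{(1)}_{j+1/2}-\mathbf F^{(1)}_{j-1/2}\big),$$ $$\mathbf F^{(1)}_{j+1/2}=\tfrac{\lambda_r\lambda_\ell}{\lambda_r-\lambda_\ell}\big(\mathbf W_{j+1}^{(1),n}-\mathbf W_j^{(1),n}\big)-\tfrac1{\lambda_r-\lambda_\ell}\big(\lambda_\ell\mathbf f^{(1)}(\mathbf W^R_{j+1/2}(\Delta t))-\lambda_r\mathbf f^{(1)}(\mathbf W^L_{j+1/2}(\Delta t))\big),$$ $$\mathbf W_j^{(2),n+1}=\mathbf W_j^{(2),n}-\tfrac{\Delta t}{\Delta x}\big(\mathbf F^{(2)}_{j+1/2}-\mathbf F^{(2)}_{j-1/2}\big)-\big(e^{-\Delta t/\varepsilon}-1\big)\big(\mathbf Q(\mathbf W_j^{(1),n+1})-\mathbf W_j^{(2),n}\big),$$ $$\mathbf F^{(2)}_{j+1/2}=\tfrac{e^{-\Delta t/\varepsilon}\lambda_r\lambda_\ell}{\lambda_r-\lambda_\ell}\big(\mathbf W_{j+1}^{(2),n}-\mathbf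 W_j^{(2),n}\big)+\tfrac{\varepsilon(e^{-\Delta t/\varepsilon}-1)}{\Delta t(\lambda_r-\lambda_\ell)}\big(\lambda_\ell\mathbf f^{(2)}(\mathbf W^R_{j+1/2}(\Delta t))-\lambda_r\mathbf f^{(2)}(\mathbf W^L_{j+1/2}(\Delta t))\big).$$ *)

theory Defs
  imports "HOL-Analysis.Analysis"
begin

text \<open>\<open>f\<close> is of class \<open>C\<^sup>k\<close> on the open set \<open>S\<close>; finite dimension of the domain makes directional
  derivatives sufficient.\<close>

primrec ck_on :: "nat \<Rightarrow> ('a::real_normed_vector \<Rightarrow> 'b::real_normed_vector) \<Rightarrow> 'a set \<Rightarrow> bool" where
  "ck_on 0 = (\<lambda>f S. continuous_on S f)"
| "ck_on (Suc k) = (\<lambda>f S. (\<forall>x\<in>S. f differentiable (at x)) \<and>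
      (\<forall>v. ck_on k (\<lambda>x. frechet_derivative f (at x) v) S))"

text \<open>Smooth up to the boundary of a set that need not be open: smooth on some open neighbourhood.\<close>

definition smooth_near :: "'a set \<Rightarrow> ('a::real_normed_vector \<Rightarrow> 'b::real_normed_vector) \<Rightarrow> bool" where
  "smooth_near S f \<longleftrightarrow> (\<exists>U. open U \<and> S \<subseteq> U \<and> (\<forall>k. ck_on k f U))"

definition real_diagonalizable :: "real^'n^'n \<Rightarrow> bool" where
  "real_diagonalizable A \<longleftrightarrow>
     (\<exists>P D :: real^'n^'n. invertible P \<and> (\<forall>i j. i \<noteq> j \<longrightarrow> D $ i $ j = 0) \<and> A = P ** D ** matrix_inv P)"

definition hyperbolic_on :: "(real^'n) set \<Rightarrow> (real^'n \<Rightarrow> real^'n) \<Rightarrow> bool" where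
  "hyperbolic_on K f \<longleftrightarrow> (\<forall>W\<in>K. real_diagonalizable (matrix (frechet_derivative f (at W))))"

text \<open>For matrices (vectors of rows) this puts one block above the other, for real vectors it
  concatenates them.\<close>

definition vstack :: "'a^'k \<Rightarrow> 'a^'m \<Rightarrow> 'a^('k + 'm)" where
  "vstack A B = (\<chi> i. case i of Inl a \<Rightarrow> A $ a | Inr b \<Rightarrow> B $ b)"

text \<open>The state \<open>W\<close> with \<open>M1 *v W = V\<close> and \<open>M2 *v W = Z\<close>.\<close>

definition state :: "real^'n^'k \<Rightarrow> real^'n^'m \<Rightarrow> (real^'k) \<times> (real^'m) \<Rightarrow> real^'n" where
  "state M1 M2 U = matrix_inv (vstack M1 M2) *v vstack (fst U) (snd U)"

lemma state_components:
  fixes M1 :: "real^'n^'k" and M2 :: "real^'n^'m"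
  assumes "invertible (vstack M1 M2)"
  shows "M1 *v W = V \<and> M2 *v W = Z \<longleftrightarrow> W = state M1 M2 (V, Z)"
proof -
  have stack_mult: "vstack M1 M2 *v W = vstack (M1 *v W) (M2 *v W)"
    by (auto simp: vec_eq_iff vstack_def matrix_vector_mult_def split: sum.splits)
  have stack_inj: "vstack A B = vstack C D \<longleftrightarrow> A = C \<and> B = D"
    for A C :: "real^'k" and B D :: "real^'m"
  proof
    assume eq: "vstack A B = vstack C D"
    have "A $ a = C $ a" for a
      using arg_cong[OF eq, of "\<lambda>x. x $ Inl a"] by (simp add: vstack_def)
    moreover have "B $ b = D $ b" for b
      using arg_cong[OF eq, of "\<lambda>x. x $ Inr b"] by (simp add: vstack_def)
    ultimately show "A = C \<and> B = D" by (simp add: vec_eq_iff)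
  qed simp
  have inv: "vstack M1 M2 ** matrix_inv (vstack M1 M2) = mat 1"
    "matrix_inv (vstack M1 M2) ** vstack M1 M2 = mat 1"
    using assms someI_ex[of "\<lambda>B. vstack M1 M2 ** B = mat 1 \<and> B ** vstack M1 M2 = mat 1"]
    by (auto simp: matrix_inv_def invertible_def)
  have "W = matrix_inv (vstack M1 M2) *v vstack V Z \<longleftrightarrow> vstack M1 M2 *v W = vstack V Z"
    by (metis inv matrix_vector_mul_assoc matrix_vector_mul_lid)
  then show ?thesis
    by (simp add: state_def stack_mult stack_inj)
qed

definition relax_solution ::
  "(real^'n) set \<Rightarrow> (real^'n \<Rightarrow> real^'n) \<Rightarrow> real \<Rightarrow> real^'n \<Rightarrow> (real \<Rightarrow> real^'n) \<Rightarrow> bool" where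
  "relax_solution K R \<epsilon> W0 w \<longleftrightarrow> w 0 = W0 \<and>
     (\<forall>t\<ge>0. w t \<in> K \<and> (w has_vector_derivative (1 / \<epsilon>) *\<^sub>R R (w t)) (at t within {0..}))"

text \<open>Only values at \<open>t \<ge> 0\<close> are used; there the solution exists and is unique under the structural
  assumptions on \<open>R\<close>, see \<open>relax_flow_eq\<close> below.\<close>

definition relax_flow ::
  "(real^'n) set \<Rightarrow> (real^'n \<Rightarrow> real^'n) \<Rightarrow> real \<Rightarrow> real^'n \<Rightarrow> real \<Rightarrow> real^'n" where
  "relax_flow K R \<epsilon> W0 = (SOME w. relax_solution K R \<epsilon> W0 w)"

lemma relax_flow_eq:
  fixes M1 :: "real^'n^'k" and M2 :: "real^'n^'m"
  assumes inv: "invertible (vstack M1 M2)" and K: "convex K" "W0 \<in> K"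
    and R1: "\<forall>W\<in>K. M1 *v R W = 0"
    and R2: "\<forall>W\<in>K. M2 *v R W = Q (M1 *v W) - M2 *v W"
    and eq: "\<forall>W\<in>K. state M1 M2 (M1 *v W, Q (M1 *v W)) \<in> K"
    and \<epsilon>: "\<epsilon> > 0"
  defines "We \<equiv> state M1 M2 (M1 *v W0, Q (M1 *v W0))"
  shows "\<exists>w. relax_solution K R \<epsilon> W0 w"
    and "relax_solution K R \<epsilon> W0 w \<Longrightarrow> t \<ge> 0 \<Longrightarrow> w t = We + exp (- t / \<epsilon>) *\<^sub>R (W0 - We)"
    and "t \<ge> 0 \<Longrightarrow> relax_flow K R \<epsilon> W0 t = We + exp (- t / \<epsilon>) *\<^sub>R (W0 - We)"
proof -
  have We: "M1 *v We = M1 *v W0" "M2 *v We = Q (M1 *v W0)" "We \<in> K"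
    using state_components[OF inv, of We] eq K by (auto simp: We_def)
  have ext: "x = y" if "M1 *v x = M1 *v y" "M2 *v x = M2 *v y" for x y
    using that state_components[OF inv] by metis
  have R: "R x = We - x" if "x \<in> K" "M1 *v x = M1 *v W0" for x
    by (rule ext) (use that R1 R2 We in \<open>auto simp: matrix_vector_mult_diff_distrib\<close>)
  define z where "z = (\<lambda>t. We + exp (- t / \<epsilon>) *\<^sub>R (W0 - We))"
  have zK: "z t \<in> K" if "t \<ge> 0" for t
  proof -
    have "(1 - exp (- t / \<epsilon>)) *\<^sub>R We + exp (- t / \<epsilon>) *\<^sub>R W0 \<in> K"
      using that \<epsilon> K We by (intro convexD) auto
    then show ?thesis by (simp add: z_def algebra_simps)
  qed
  have z1: "M1 *v z t = M1 *v W0" for t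
    by (simp add: z_def We matrix_vector_right_distrib matrix_vector_mult_diff_distrib
        matrix_vector_mult_scaleR)
  have "relax_solution K R \<epsilon> W0 z"
    unfolding relax_solution_def
  proof (intro conjI allI impI)
    show "z 0 = W0" by (simp add: z_def)
    fix t :: real assume t: "t \<ge> 0"
    show "z t \<in> K" by (rule zK[OF t])
    have "(z has_vector_derivative (- (1 / \<epsilon>) * exp (- t / \<epsilon>)) *\<^sub>R (W0 - We)) (at t within {0..})"
      unfolding z_def using \<epsilon> by (auto intro!: derivative_eq_intros)
    also have "(- (1 / \<epsilon>) * exp (- t / \<epsilon>)) *\<^sub>R (W0 - We) = (1 / \<epsilon>) *\<^sub>R R (z t)"
      by (simp add: R[OF zK[OF t] z1]) (simp add: z_def)
    finally show "(z has_vector_derivative (1 / \<epsilon>) *\<^sub>R R (z t)) (at t within {0..})" .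
  qed
  then show ex: "\<exists>w. relax_solution K R \<epsilon> W0 w" by blast
  show uniq: "w t = We + exp (- t / \<epsilon>) *\<^sub>R (W0 - We)"
    if w: "relax_solution K R \<epsilon> W0 w" and t: "t \<ge> 0" for w t
  proof -
    have w0: "w 0 = W0" and wK: "\<And>t. t \<ge> 0 \<Longrightarrow> w t \<in> K"
      and wd: "\<And>t. t \<ge> 0 \<Longrightarrow> (w has_vector_derivative (1 / \<epsilon>) *\<^sub>R R (w t)) (at t within {0..})"
      using w by (auto simp: relax_solution_def)
    have "((\<lambda>t. M1 *v w t) has_vector_derivative M1 *v ((1 / \<epsilon>) *\<^sub>R R (w t))) (at t within {0..})"
      if "t \<ge> 0" for t
      using bounded_linear.has_vector_derivative[OF matrix_vector_mul_bounded_linear wd[OF that]] .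
    then have "((\<lambda>t. M1 *v w t) has_vector_derivative 0) (at t within {0..})" if "t \<ge> 0" for t
      using that R1 wK by (simp add: matrix_vector_mult_scaleR)
    then obtain c where c: "\<And>t. t \<in> {0..} \<Longrightarrow> M1 *v w t = c"
      using has_vector_derivative_zero_constant[of "{0..}" "\<lambda>t. M1 *v w t"] by auto
    have w1: "M1 *v w t = M1 *v W0" if "t \<ge> 0" for t
      using c[of t] c[of 0] that w0 by simp
    have "((\<lambda>t. exp (t / \<epsilon>) *\<^sub>R (w t - We)) has_vector_derivative 0) (at t within {0..})"
      if t: "t \<in> {0..}" for t
    proof -
      have t0: "t \<ge> 0" using t by simp
      have "((\<lambda>t. exp (t / \<epsilon>) *\<^sub>R (w t - We)) has_vector_derivative
          exp (t / \<epsilon>) *\<^sub>R ((1 / \<epsilon>) *\<^sub>R R (w t) - 0) + (exp (t / \<epsilon>) * (1 / \<epsilon>)) *\<^sub>R (w t - We))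
          (at t within {0..})"
        using \<epsilon> by (intro has_vector_derivative_scaleR has_vector_derivative_diff wd[OF t0]
            has_vector_derivative_const) (auto intro!: derivative_eq_intros)
      then show ?thesis
        by (simp add: R[OF wK[OF t0] w1[OF t0]] algebra_simps)
    qed
    then obtain d where d: "\<And>t. t \<in> {0..} \<Longrightarrow> exp (t / \<epsilon>) *\<^sub>R (w t - We) = d"
      using has_vector_derivative_zero_constant[of "{0..}" "\<lambda>t. exp (t / \<epsilon>) *\<^sub>R (w t - We)"] by auto
    have "exp (t / \<epsilon>) *\<^sub>R (w t - We) = W0 - We"
      using d[of t] d[of 0] t w0 by simp
    then have "exp (- t / \<epsilon>) *\<^sub>R exp (t / \<epsilon>) *\<^sub>R (w t - We) = exp (- t / \<epsilon>) *\<^sub>R (W0 - We)"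
      by simp
    then have "w t - We = exp (- t / \<epsilon>) *\<^sub>R (W0 - We)"
      by (simp add: exp_minus)
    then show ?thesis by (simp add: algebra_simps)
  qed
  show "relax_flow K R \<epsilon> W0 t = We + exp (- t / \<epsilon>) *\<^sub>R (W0 - We)" if "t \<ge> 0"
    using uniq[OF _ that] someI_ex[OF ex] by (simp add: relax_flow_def)
qed

text \<open>\<open>sl < 0 < sr\<close> are the wave speeds. Cell values are pairs \<open>(W1, W2)\<close>; \<open>UL\<close> and \<open>UR\<close> are those to
  the left and to the right of an interface.\<close>

definition ar_flux1 ::
  "(real^'n) set \<Rightarrow> (real^'n \<Rightarrow> real^'n) \<Rightarrow> (real^'n \<Rightarrow> real^'n) \<Rightarrow> real^'n^'k \<Rightarrow> real^'n^'m \<Rightarrow>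
   real \<Rightarrow> real \<Rightarrow> real \<Rightarrow> real \<Rightarrow> (real^'k) \<times> (real^'m) \<Rightarrow> (real^'k) \<times> (real^'m) \<Rightarrow> real^'k" where
  "ar_flux1 K f R M1 M2 sl sr \<epsilon> dt UL UR =
     (let WR = relax_flow K R \<epsilon> (state M1 M2 UR) dt;
          WL = relax_flow K R \<epsilon> (state M1 M2 UL) dt
      in (sr * sl / (sr - sl)) *\<^sub>R (fst UR - fst UL)
         - (1 / (sr - sl)) *\<^sub>R (sl *\<^sub>R (M1 *v f WR) - sr *\<^sub>R (M1 *v f WL)))"

definition ar_flux2 ::
  "(real^'n) set \<Rightarrow> (real^'n \<Rightarrow> real^'n) \<Rightarrow> (real^'n \<Rightarrow> real^'n) \<Rightarrow> real^'n^'k \<Rightarrow> real^'n^'m \<Rightarrow>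
   real \<Rightarrow> real \<Rightarrow> real \<Rightarrow> real \<Rightarrow> (real^'k) \<times> (real^'m) \<Rightarrow> (real^'k) \<times> (real^'m) \<Rightarrow> real^'m" where
  "ar_flux2 K f R M1 M2 sl sr \<epsilon> dt UL UR =
     (let WR = relax_flow K R \<epsilon> (state M1 M2 UR) dt;
          WL = relax_flow K R \<epsilon> (state M1 M2 UL) dt
      in (exp (- dt / \<epsilon>) * sr * sl / (sr - sl)) *\<^sub>R (snd UR - snd UL)
         + (\<epsilon> * (exp (- dt / \<epsilon>) - 1) / (dt * (sr - sl))) *\<^sub>R
             (sl *\<^sub>R (M2 *v f WR) - sr *\<^sub>R (M2 *v f WL)))"

definition ar_flux where
  "ar_flux K f R M1 M2 sl sr \<epsilon> dt UL UR =
     (ar_flux1 K f R M1 M2 sl sr \<epsilon> dt UL UR, ar_flux2 K f R M1 M2 sl sr \<epsilon> dt UL UR)"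

definition ar_step ::
  "(real^'n) set \<Rightarrow> (real^'n \<Rightarrow> real^'n) \<Rightarrow> (real^'n \<Rightarrow> real^'n) \<Rightarrow> (real^'k \<Rightarrow> real^'m) \<Rightarrow>
   real^'n^'k \<Rightarrow> real^'n^'m \<Rightarrow> real \<Rightarrow> real \<Rightarrow> real \<Rightarrow> real \<Rightarrow> real \<Rightarrow>
   (int \<Rightarrow> (real^'k) \<times> (real^'m)) \<Rightarrow> int \<Rightarrow> (real^'k) \<times> (real^'m)" where
  "ar_step K f R Q M1 M2 sl sr \<epsilon> dt dx U j =
     (let F1 = ar_flux1 K f R M1 M2 sl sr \<epsilon> dt;
          F2 = ar_flux2 K f R M1 M2 sl sr \<epsilon> dt;
          V = fst (U j) - (dt / dx) *\<^sub>R (F1 (U j) (U (j + 1)) - F1 (U (j - 1)) (U j));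
          Z = snd (U j) - (dt / dx) *\<^sub>R (F2 (U j) (U (j + 1)) - F2 (U (j - 1)) (U j))
                - (exp (- dt / \<epsilon>) - 1) *\<^sub>R (Q V - snd (U j))
      in (V, Z))"

definition f_eq ::
  "(real^'n \<Rightarrow> real^'n) \<Rightarrow> (real^'k \<Rightarrow> real^'m) \<Rightarrow> real^'n^'k \<Rightarrow> real^'n^'m \<Rightarrow> real^'k \<Rightarrow> real^'k" where
  "f_eq f Q M1 M2 V = M1 *v f (state M1 M2 (V, Q V))"

definition hll_flux ::
  "('v::real_vector \<Rightarrow> 'v) \<Rightarrow> real \<Rightarrow> real \<Rightarrow> 'v \<Rightarrow> 'v \<Rightarrow> 'v" where
  "hll_flux g sl sr VL VR =
     (1 / (sr - sl)) *\<^sub>R (sr *\<^sub>R g VL - sl *\<^sub>R g VR + (sr * sl) *\<^sub>R (VR - VL))"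

definition hll_step ::
  "('v::real_vector \<Rightarrow> 'v) \<Rightarrow> real \<Rightarrow> real \<Rightarrow> real \<Rightarrow> real \<Rightarrow> (int \<Rightarrow> 'v) \<Rightarrow> int \<Rightarrow> 'v" where
  "hll_step g sl sr dt dx V j =
     V j - (dt / dx) *\<^sub>R (hll_flux g sl sr (V j) (V (j + 1)) - hll_flux g sl sr (V (j - 1)) (V j))"

text \<open>The constant state between the two waves of the HLL approximate Riemann solver.\<close>

definition hll_middle ::
  "('v::real_vector \<Rightarrow> 'v) \<Rightarrow> real \<Rightarrow> real \<Rightarrow> 'v \<Rightarrow> 'v \<Rightarrow> 'v" where
  "hll_middle g sl sr VL VR =
     (1 / (sr - sl)) *\<^sub>R (sr *\<^sub>R VR - sl *\<^sub>R VL - (g VR - g VL))"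

text \<open>Stability as preservation of convex invariant domains: wave speeds that are large enough for
  the Riemann solver not to leave \<open>D\<close> make the scheme stay in \<open>D\<close>.\<close>

definition hll_stable ::
  "'v set \<Rightarrow> ('v::real_vector \<Rightarrow> 'v) \<Rightarrow> real \<Rightarrow> real \<Rightarrow> real \<Rightarrow> real \<Rightarrow> bool" where
  "hll_stable A g sl sr dt dx \<longleftrightarrow>
     (\<forall>D V. convex D \<and> D \<subseteq> A \<and> (\<forall>j. V j \<in> D) \<and> (\<forall>j. hll_middle g sl sr (V j) (V (j + 1)) \<in> D)
        \<longrightarrow> (\<forall>j. hll_step g sl sr dt dx V j \<in> D))"

definition classical_solution ::
  "real \<Rightarrow> 'v set \<Rightarrow> ('v::euclidean_space \<Rightarrow> 'v) \<Rightarrow> ('v \<Rightarrow> 'v) \<Rightarrow> (real \<Rightarrow> real \<Rightarrow> 'v) \<Rightarrow> bool" where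
  "classical_solution T A g s u \<longleftrightarrow>
     ck_on 1 (\<lambda>(t, x). u t x) ({0<..<T} \<times> UNIV) \<and>
     (\<forall>t\<in>{0<..<T}. \<forall>x. u t x \<in> A \<and>
        vector_derivative (\<lambda>t'. u t' x) (at t) + vector_derivative (\<lambda>y. g (u t y)) (at x) = s (u t x))"

definition cell_average :: "real \<Rightarrow> (real \<Rightarrow> 'v::euclidean_space) \<Rightarrow> real \<Rightarrow> 'v" where
  "cell_average dx v x = (1 / dx) *\<^sub>R integral {x - dx / 2 .. x + dx / 2} v"

text \<open>The defect after one step started from the exact cell averages of \<open>u\<close> at time \<open>t\<close> on the mesh
  whose cell number \<open>0\<close> is centred at \<open>x\<close>, divided by the time step.\<close>

definition truncation_error ::
  "(real \<Rightarrow> real \<Rightarrow> (int \<Rightarrow> 'v::euclidean_space) \<Rightarrow> int \<Rightarrow> 'v) \<Rightarrow> (real \<Rightarrow> real \<Rightarrow> 'v) \<Rightarrow>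
   real \<Rightarrow> real \<Rightarrow> real \<Rightarrow> real \<Rightarrow> 'v" where
  "truncation_error step u dt dx t x =
     (1 / dt) *\<^sub>R (cell_average dx (u (t + dt)) x
                    - step dt dx (\<lambda>j. cell_average dx (u t) (x + of_int j * dx)) 0)"

text \<open>Consistency with \<open>\<partial>\<^sub>t u + \<partial>\<^sub>x g(u) = s(u)\<close>, \<open>u \<in> A\<close>, with \<open>\<mu>\<close> the largest wave speed.
  The numerical flux \<open>F\<close> may depend on the time step, so its agreement with \<open>g\<close> on equal arguments
  is required as \<open>dt \<rightarrow> 0\<close>. The truncation error has to vanish locally uniformly as the mesh is
  refined under the CFL condition; local uniformity in
  \<open>(t, x)\<close> is what covers all cells of an actual mesh, whose centres move as \<open>dx \<rightarrow> 0\<close>.\<close>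

definition fv_consistent ::
  "'v set \<Rightarrow> ('v::euclidean_space \<Rightarrow> 'v) \<Rightarrow> ('v \<Rightarrow> 'v) \<Rightarrow> real \<Rightarrow> (real \<Rightarrow> 'v \<Rightarrow> 'v \<Rightarrow> 'v) \<Rightarrow>
   (real \<Rightarrow> real \<Rightarrow> (int \<Rightarrow> 'v) \<Rightarrow> int \<Rightarrow> 'v) \<Rightarrow> bool" where
  "fv_consistent A g s \<mu> F step \<longleftrightarrow>
     (\<forall>v\<in>A. ((\<lambda>dt. F dt v v) \<longlongrightarrow> g v) (at_right 0)) \<and>
     (\<forall>T u C. classical_solution T A g s u \<and> compact C \<and> C \<subseteq> {0<..<T} \<times> UNIV \<longrightarrow>
        uniform_limit C (\<lambda>(dt, dx) (t, x). truncation_error step u dt dx t x) (\<lambda>_. 0)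
          (at (0, 0) within {(dt, dx). dt > 0 \<and> dx > 0 \<and> dt / dx * \<mu> \<le> 1 / 2}))"

end

theory Submission
  imports Defs
begin

text \<open>The conserved part \<open>W\<^sup>1 = M1 W\<close> is constant along the relaxation ODE and the other part decays
exponentially to \<open>Q W\<^sup>1\<close>, so the flow of the ODE is the explicit convex combination
\<open>W\<^sub>e + exp (- t / \<epsilon>) (W - W\<^sub>e)\<close>, where \<open>W\<^sub>e\<close> is the equilibrium state with the same conserved
part. Both regimes of the scheme are visible in this formula.

For fixed \<open>\<epsilon>\<close> and \<open>dt \<rightarrow> 0\<close> the flow tends to the identity, together with its derivative. Hence the
flux evaluated after the relaxation step has the same difference quotients in the limit as \<open>f\<close>
itself, and the scheme is a consistent HLL discretisation of the full system
(\<open>relax_flow_quotient\<close>, \<open>ar_consistent\<close>). For fixed \<open>dt\<close> and \<open>\<epsilon> \<rightarrow> 0\<close> the flow tends to the projection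
onto equilibrium states, so the flux of the conserved part becomes the HLL flux for
\<open>f\<^sub>e\<^sub>q\<close> (\<open>stiff_limit\<close>).

Consistency of both schemes rests on one criterion (\<open>fv_consistentI\<close>). Cell averages of a classical
solution merge to its value, their slopes converge to its space derivative and their time differences
to its time derivative, because a \<open>C\<^sup>1\<close> map is strictly differentiable. A scheme is then consistent
if, along any cell values that merge with convergent slopes, its increment per time step tends to
source minus flux derivative. Uniformity on compact sets is obtained by letting the space-time point
vary along the filter of the limit. That averages stay admissible, although the set of admissible
states is only assumed convex, is \<open>cell_average_in_convex\<close>.

Stability of the limit scheme holds because each updated value is a convex combination of the old
value and the two intermediate states of the neighbouring Riemann solvers, with weights made
nonnegative by the CFL condition (\<open>hll_step_convex_combination\<close>).\<close>

section \<open>Difference quotients along filters\<close>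

lemma ck1_has_derivative:
  assumes "ck_on 1 g S" "x \<in> S"
  shows "(g has_derivative frechet_derivative g (at x)) (at x)"
  using assms by (auto simp: frechet_derivative_works)

text \<open>A \<open>C\<^sup>1\<close> map is strictly differentiable: near \<open>p\<close> the map minus its linearisation at \<open>p\<close> has an
arbitrarily small Lipschitz constant, by the mean value inequality. Strictness matters because
finite-volume fluxes take differences between two neighbouring values neither of which is the
limit point.\<close>

lemma ck1_strictly_differentiable:
  fixes g :: "'a::euclidean_space \<Rightarrow> 'b::real_normed_vector"
  assumes g: "ck_on 1 g S" and S: "open S" "p \<in> S" and e: "0 < e"
  shows "\<exists>d>0. \<forall>y\<in>ball p d. \<forall>z\<in>ball p d.
    norm (g y - g z - frechet_derivative g (at p) (y - z)) \<le> e * norm (y - z)"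
proof -
  let ?D = "\<lambda>x. frechet_derivative g (at x)"
  define N where "N = (\<lambda>x. \<Sum>b\<in>Basis. norm (?D x b - ?D p b))"
  have deriv: "(g has_derivative ?D x) (at x)" if "x \<in> S" for x
    using ck1_has_derivative[OF g that] .
  have "continuous_on S (\<lambda>x. ?D x b)" for b
    using g by simp
  then have "continuous_on S N"
    unfolding N_def by (intro continuous_intros)
  then have "isCont N p"
    using S by (simp add: continuous_on_eq_continuous_at)
  then obtain d1 where d1: "d1 > 0" "\<And>x. dist x p < d1 \<Longrightarrow> dist (N x) (N p) < e"
    using e unfolding continuous_at by (metis (no_types) LIM_def dist_self isCont_def)
  obtain d2 where d2: "d2 > 0" "ball p d2 \<subseteq> S"
    using S open_contains_ball by blast
  define d where "d = min d1 d2"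
  have d: "d > 0" "ball p d \<subseteq> S"
    using d1 d2 by (auto simp: d_def)
  have N: "onorm (?D x - ?D p) \<le> e" if x: "x \<in> ball p d" for x
  proof -
    have "bounded_linear (?D x - ?D p)"
      using has_derivative_bounded_linear[OF deriv] d x S unfolding fun_diff_def
      by (intro bounded_linear_sub) auto
    then have "onorm (?D x - ?D p) \<le> N x"
      using onorm_componentwise by (fastforce simp: N_def)
    also have "N x < e"
      using d1(2)[of x] x by (auto simp: d_def dist_commute N_def dist_norm)
    finally show ?thesis by simp
  qed
  have "norm (g y - g z - ?D p (y - z)) \<le> norm (y - z) * e"
    if yz: "y \<in> ball p d" "z \<in> ball p d" for y z
  proof (rule differentiable_bound_linearization[where S = "ball p d"])
    show "z + t *\<^sub>R (y - z) \<in> ball p d" if "t \<in> {0..1}" for t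
    proof -
      have "(1 - t) *\<^sub>R z + t *\<^sub>R y \<in> ball p d"
        using that yz by (intro convexD convex_ball) auto
      then show ?thesis by (simp add: algebra_simps)
    qed
    show "(g has_derivative ?D x) (at x within ball p d)" if "x \<in> ball p d" for x
      using that d by (meson deriv has_derivative_at_withinI subsetD)
  qed (use N d in auto)
  then show ?thesis
    using d(1) by (auto simp: mult.commute)
qed

text \<open>The chain rule in the form used throughout: every flux difference divided by the mesh size is a
difference quotient of a smooth map at two points that merge in the limit. The divisor \<open>h\<close> is any
function of the parameter; only the quotient of the arguments has to converge.\<close>

lemma difference_quotient_chain:
  fixes g :: "'a::euclidean_space \<Rightarrow> 'b::real_normed_vector"
  assumes g: "ck_on 1 g S" and S: "open S" "p \<in> S"
    and b: "(b \<longlongrightarrow> p) F" and c: "(c \<longlongrightarrow> p) F"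
    and q: "((\<lambda>i. (1 / h i) *\<^sub>R (b i - c i)) \<longlongrightarrow> w) F"
  shows "((\<lambda>i. (1 / h i) *\<^sub>R (g (b i) - g (c i))) \<longlongrightarrow> frechet_derivative g (at p) w) F"
proof -
  let ?D = "frechet_derivative g (at p)"
  have D: "bounded_linear ?D"
    using ck1_has_derivative[OF g S(2)] by (rule has_derivative_bounded_linear)
  define r where "r = (\<lambda>i. (1 / h i) *\<^sub>R (g (b i) - g (c i) - ?D (b i - c i)))"
  have "(r \<longlongrightarrow> 0) F"
  proof (rule tendstoI)
    fix e :: real assume e: "e > 0"
    \<comment> \<open>The quotients \<open>q\<close> are eventually bounded by \<open>norm w + 1\<close>.\<close>
    define e' where "e' = e / (norm w + 1)"
    have e': "e' > 0"
      using e by (auto simp: e'_def intro!: divide_pos_pos add_nonneg_pos)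
    then obtain d where d: "d > 0" and bound: "\<And>y z. y \<in> ball p d \<Longrightarrow> z \<in> ball p d \<Longrightarrow>
        norm (g y - g z - ?D (y - z)) \<le> e' * norm (y - z)"
      using ck1_strictly_differentiable[OF g S] by meson
    have "\<forall>\<^sub>F i in F. b i \<in> ball p d" "\<forall>\<^sub>F i in F. c i \<in> ball p d"
      using tendstoD[OF b d] tendstoD[OF c d] by (simp_all add: dist_commute)
    moreover have "\<forall>\<^sub>F i in F. norm ((1 / h i) *\<^sub>R (b i - c i)) < norm w + 1"
      using order_tendstoD(2)[OF tendsto_norm[OF q]] by simp
    ultimately show "\<forall>\<^sub>F i in F. dist (r i) 0 < e"
    proof eventually_elim
      case (elim i)
      have "norm (r i) = \<bar>1 / h i\<bar> * norm (g (b i) - g (c i) - ?D (b i - c i))"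
        by (simp add: r_def)
      also have "\<dots> \<le> \<bar>1 / h i\<bar> * (e' * norm (b i - c i))"
        using elim by (intro mult_left_mono bound) auto
      also have "\<dots> = e' * norm ((1 / h i) *\<^sub>R (b i - c i))"
        by simp
      also have "\<dots> < e' * (norm w + 1)"
        using elim e' by (intro mult_strict_left_mono) auto
      also have "e' * (norm w + 1) = e"
        using norm_ge_zero[of w] by (auto simp: e'_def add_nonneg_eq_0_iff simp del: norm_ge_zero)
      finally show ?case by simp
    qed
  qed
  from tendsto_add[OF this bounded_linear.tendsto[OF D q]] show ?thesis
    by (simp add: r_def linear_cmul[OF bounded_linear.linear[OF D]] scaleR_add_right[symmetric])
qed

text \<open>Compactness turns a limit that is joint in the parameter and the point into a uniform one. With
this the truncation error can be computed by ordinary limit rules along a product filter.\<close>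

lemma uniform_limit_on_compactI:
  fixes f :: "'h \<Rightarrow> 'a::topological_space \<Rightarrow> 'b::metric_space"
  assumes C: "compact C"
    and lim: "\<And>p. p \<in> C \<Longrightarrow> ((\<lambda>(h, q). f h q) \<longlongrightarrow> l) (F \<times>\<^sub>F nhds p)"
  shows "uniform_limit C f (\<lambda>_. l) F"
proof (rule uniform_limitI)
  fix e :: real assume e: "e > 0"
  have "\<exists>P N. eventually P F \<and> open N \<and> p \<in> N \<and> (\<forall>h q. P h \<longrightarrow> q \<in> N \<longrightarrow> dist (f h q) l < e)"
    if p: "p \<in> C" for p
    using tendstoD[OF lim[OF p] e] unfolding eventually_prod_filter eventually_nhds
    by (smt (verit, best) case_prod_conv)
  then obtain P N where PN: "\<And>p. p \<in> C \<Longrightarrow> eventually (P p) F"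
      "\<And>p. p \<in> C \<Longrightarrow> open (N p)" "\<And>p. p \<in> C \<Longrightarrow> p \<in> N p"
      "\<And>p h q. p \<in> C \<Longrightarrow> P p h \<Longrightarrow> q \<in> N p \<Longrightarrow> dist (f h q) l < e"
    by metis
  obtain C' where C': "C' \<subseteq> C" "finite C'" "C \<subseteq> (\<Union>p\<in>C'. N p)"
    using compactE_image[OF C, of C N] PN by (metis UN_I subsetI)
  have "\<forall>\<^sub>F h in F. \<forall>p\<in>C'. P p h"
    using C' PN(1) by (intro eventually_ball_finite) auto
  then show "\<forall>\<^sub>F h in F. \<forall>q\<in>C. dist (f h q) l < e"
    by eventually_elim (use C' PN(4) in blast)
qed

section \<open>Cell averages\<close>

text \<open>The convex set need not be closed, so a limit of Riemann sums would not be enough. The image of the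
cell is compact, its convex hull is compact in finite dimension, and a point outside a closed convex
set is cut off by a hyperplane, which integration preserves. Both uses matter: averages of an
admissible solution are admissible, so that the relaxation flow is defined on them, and averages of
values in a ball stay in the ball.\<close>

lemma cell_average_in_convex:
  fixes v :: "real \<Rightarrow> 'v::euclidean_space"
  assumes A: "convex A" and dx: "0 < dx" and v: "continuous_on {x - dx / 2 .. x + dx / 2} v"
    and in_A: "\<And>y. y \<in> {x - dx / 2 .. x + dx / 2} \<Longrightarrow> v y \<in> A"
  shows "cell_average dx v x \<in> A"
proof -
  let ?I = "{x - dx / 2 .. x + dx / 2}"
  let ?S = "convex hull (v ` ?I)"
  have "cell_average dx v x \<in> ?S"
  proof (rule ccontr)
    assume "cell_average dx v x \<notin> ?S"
    moreover have "closed ?S"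
      using v by (intro compact_imp_closed compact_convex_hull compact_continuous_image) auto
    ultimately obtain a b where ab: "a \<bullet> cell_average dx v x < b" "\<And>z. z \<in> ?S \<Longrightarrow> b < a \<bullet> z"
      using separating_hyperplane_closed_point[OF convex_convex_hull] by metis
    have int: "v integrable_on ?I"
      using v by (rule integrable_continuous_interval)
    have "integral ?I (\<lambda>_. b) \<le> integral ?I (\<lambda>y. v y \<bullet> a)"
    proof (rule integral_le)
      show "(\<lambda>y. v y \<bullet> a) integrable_on ?I"
        using v by (intro integrable_continuous_interval continuous_intros)
      show "b \<le> v y \<bullet> a" if "y \<in> ?I" for y
        using ab(2)[of "v y"] that by (auto simp: hull_inc inner_commute intro: less_imp_le)
    qed auto
    then have "dx * b \<le> integral ?I v \<bullet> a"
      using int dx by simp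
    then show False
      using ab(1) dx by (simp add: cell_average_def inner_commute field_simps)
  qed
  also have "?S \<subseteq> A"
    using A in_A by (intro hull_minimal) auto
  finally show ?thesis .
qed

text \<open>The product filter lets the point of evaluation range over a shrinking cell independently of its
centre; \<open>cell_average_in_convex\<close> for balls then transfers the limit to the averages.\<close>

lemma cell_average_tendsto:
  fixes \<phi> :: "'i \<Rightarrow> real \<Rightarrow> 'v::euclidean_space"
  assumes lim: "((\<lambda>(i, y). \<phi> i y) \<longlongrightarrow> w) (F \<times>\<^sub>F nhds x0)"
    and dx: "(dx \<longlongrightarrow> 0) F" "\<forall>\<^sub>F i in F. 0 < dx i"
    and x: "(x \<longlongrightarrow> x0) F"
    and cont: "\<forall>\<^sub>F i in F. continuous_on UNIV (\<phi> i)"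
  shows "((\<lambda>i. cell_average (dx i) (\<phi> i) (x i)) \<longlongrightarrow> w) F"
proof (rule tendstoI)
  fix e :: real assume e: "e > 0"
  obtain P N where P: "eventually P F" and N: "eventually N (nhds x0)"
    and PN: "\<And>i y. P i \<Longrightarrow> N y \<Longrightarrow> dist (\<phi> i y) w < e"
    using tendstoD[OF lim e] unfolding eventually_prod_filter by auto
  obtain d where d: "d > 0" "\<And>y. dist y x0 < d \<Longrightarrow> N y"
    using N unfolding eventually_nhds_metric by auto
  have "\<forall>\<^sub>F i in F. dx i < d" "\<forall>\<^sub>F i in F. dist (x i) x0 < d / 2"
    using order_tendstoD(2)[OF dx(1) d(1)] tendstoD[OF x, of "d / 2"] d(1) by auto
  with P dx(2) cont show "\<forall>\<^sub>F i in F. dist (cell_average (dx i) (\<phi> i) (x i)) w < e"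
  proof eventually_elim
    case (elim i)
    have "cell_average (dx i) (\<phi> i) (x i) \<in> ball w e"
    proof (rule cell_average_in_convex)
      show "continuous_on {x i - dx i / 2..x i + dx i / 2} (\<phi> i)"
        using elim(3) continuous_on_subset by blast
      show "\<phi> i y \<in> ball w e" if "y \<in> {x i - dx i / 2..x i + dx i / 2}" for y
      proof -
        have "\<bar>y - x i\<bar> \<le> dx i / 2"
          using that unfolding atLeastAtMost_iff by linarith
        then have "dist y x0 < d"
          using elim unfolding dist_real_def by linarith
        then show ?thesis
          using PN d(2) elim(1) by (simp add: dist_commute)
      qed
    qed (use elim in auto)
    then show ?case by (simp add: dist_commute)
  qed
qed

lemma cell_average_difference:
  assumes "continuous_on UNIV v" "continuous_on UNIV v'"
  shows "a *\<^sub>R (cell_average dx v x - cell_average dx v' x) =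
    cell_average dx (\<lambda>y. a *\<^sub>R (v y - v' y)) x"
proof -
  have "v integrable_on {p..q}" "v' integrable_on {p..q}" for p q
    using assms by (auto intro!: integrable_continuous_interval intro: continuous_on_subset)
  then show ?thesis
    by (simp add: cell_average_def integral_diff mult.commute flip: scaleR_diff_right)
qed

lemma cell_average_shift: "cell_average dx v (x + c) = cell_average dx (\<lambda>y. v (y + c)) x"
  using integral_shift_Icc_real[of "x - dx / 2" "x + dx / 2" v c]
  by (simp add: cell_average_def o_def algebra_simps)

section \<open>A consistency criterion for finite-volume schemes\<close>

text \<open>All that consistency needs from the partial differential equation is isolated here. Let the time
step, the mesh size and the space-time point vary together. If the cell values \<open>U\<close> merge to \<open>v\<close> and
their slopes converge to \<open>w\<close>, it is enough that the increment of the scheme per time step tends to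
\<open>s v - g' v w\<close>: for averages of a classical solution, \<open>w\<close> is the space derivative, the averages at
the next time contribute the time derivative, and the equation makes the two limits equal. Slopes
and time differences of averages are averages of difference quotients of the solution, so they
converge by its strict differentiability. The index type of the filter \<open>G\<close> is that of the pairs
\<open>((dt, dx), (t, x))\<close>.\<close>

lemma fv_consistentI:
  fixes A :: "'v::euclidean_space set"
  assumes A: "convex A"
    and flux: "\<And>v. v \<in> A \<Longrightarrow> ((\<lambda>dt. F dt v v) \<longlongrightarrow> g v) (at_right 0)"
    and deriv: "\<And>v. v \<in> A \<Longrightarrow> (g has_derivative g' v) (at v)"
    and step: "\<And>(G :: ((real \<times> real) \<times> (real \<times> real)) filter) dt dx U v w.
      v \<in> A \<Longrightarrow> (dt \<longlongrightarrow> 0) G \<Longrightarrow> (dx \<longlongrightarrow> 0) G \<Longrightarrow>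
      \<forall>\<^sub>F i in G. 0 < dt i \<and> 0 < dx i \<and> (\<forall>j. U i j \<in> A) \<Longrightarrow>
      (\<And>j. ((\<lambda>i. U i j) \<longlongrightarrow> v) G) \<Longrightarrow>
      (\<And>j. ((\<lambda>i. (1 / dx i) *\<^sub>R (U i (j + 1) - U i j)) \<longlongrightarrow> w) G) \<Longrightarrow>
      ((\<lambda>i. (1 / dt i) *\<^sub>R (step (dt i) (dx i) (U i) 0 - U i 0)) \<longlongrightarrow> s v - g' v w) G"
  shows "fv_consistent A g s \<mu> F step"
  unfolding fv_consistent_def
proof (intro conjI ballI allI impI)
  show "((\<lambda>dt. F dt v v) \<longlongrightarrow> g v) (at_right 0)" if "v \<in> A" for v
    using flux that .
next
  fix T u and C :: "(real \<times> real) set"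
  assume *: "classical_solution T A g s u \<and> compact C \<and> C \<subseteq> {0<..<T} \<times> UNIV"
  let ?S = "{(dt, dx). dt > 0 \<and> dx > 0 \<and> dt / dx * \<mu> \<le> 1 / 2}"
  let ?\<Omega> = "{0<..<T} \<times> (UNIV :: real set)"
  let ?u = "\<lambda>(t, x). u t x"
  have u: "ck_on 1 ?u ?\<Omega>" and uA: "\<And>t x. t \<in> {0<..<T} \<Longrightarrow> u t x \<in> A"
    and pde: "\<And>t x. t \<in> {0<..<T} \<Longrightarrow>
      vector_derivative (\<lambda>t'. u t' x) (at t) + vector_derivative (\<lambda>y. g (u t y)) (at x) = s (u t x)"
    using * by (auto simp: classical_solution_def)
  have open_\<Omega>: "open ?\<Omega>" by (intro open_Times) auto
  have contx: "continuous_on UNIV (\<lambda>y. u t (y + c))" if "t \<in> {0<..<T}" for t c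
  proof -
    have "continuous_on ?\<Omega> ?u"
      using u by (auto intro!: continuous_at_imp_continuous_on differentiable_imp_continuous_within)
    then have "continuous_on UNIV (\<lambda>y. ?u (t, y + c))"
      by (rule continuous_on_compose2) (use that in \<open>auto intro!: continuous_intros\<close>)
    then show ?thesis by simp
  qed
  show "uniform_limit C (\<lambda>(dt, dx) (t, x). truncation_error step u dt dx t x) (\<lambda>_. 0)
      (at (0, 0) within ?S)"
  proof (rule uniform_limit_on_compactI)
    show "compact C" using * by simp
    fix p assume "p \<in> C"
    then obtain t0 x0 where p: "p = (t0, x0)" and t0: "t0 \<in> {0<..<T}"
      using * by (cases p) auto
    let ?D = "frechet_derivative ?u (at (t0, x0))"
    have D: "(?u has_derivative ?D) (at (t0, x0))"
      using t0 by (intro ck1_has_derivative[OF u]) simp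
    have ut: "vector_derivative (\<lambda>t'. u t' x0) (at t0) = ?D (1, 0)"
    proof (rule vector_derivative_at)
      have "((\<lambda>t'. (t', x0)) has_derivative (\<lambda>h. (h, 0))) (at t0)"
        by (auto intro!: derivative_eq_intros)
      from has_derivative_compose[OF this, of ?u ?D] D
      have "((\<lambda>t'. u t' x0) has_derivative (\<lambda>h. ?D (h *\<^sub>R (1, 0)))) (at t0)"
        by simp
      then show "((\<lambda>t'. u t' x0) has_vector_derivative ?D (1, 0)) (at t0)"
        unfolding has_vector_derivative_def
        by (simp only: linear_cmul[OF has_derivative_linear[OF D]])
    qed
    have ux: "vector_derivative (\<lambda>y. g (u t0 y)) (at x0) = g' (u t0 x0) (?D (0, 1))"
    proof (rule vector_derivative_at)
      have g': "(g has_derivative g' (u t0 x0)) (at (u t0 x0))"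
        using deriv uA t0 by blast
      have "((\<lambda>y. (t0, y)) has_derivative (\<lambda>h. (0, h))) (at x0)"
        by (auto intro!: derivative_eq_intros)
      from has_derivative_compose[OF this, of ?u ?D] D
      have "((\<lambda>y. u t0 y) has_derivative (\<lambda>h. ?D (h *\<^sub>R (0, 1)))) (at x0)"
        by simp
      from has_derivative_compose[OF this g']
      show "((\<lambda>y. g (u t0 y)) has_vector_derivative g' (u t0 x0) (?D (0, 1))) (at x0)"
        unfolding has_vector_derivative_def
        by (simp only: linear_cmul[OF has_derivative_linear[OF D]]
            linear_cmul[OF has_derivative_linear[OF g']])
    qed
    define G where "G = (at (0, 0) within ?S) \<times>\<^sub>F nhds (t0, x0)"
    define dt dx t x :: "(real \<times> real) \<times> (real \<times> real) \<Rightarrow> real"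
      where "dt = (\<lambda>i. fst (fst i))" and "dx = (\<lambda>i. snd (fst i))"
        and "t = (\<lambda>i. fst (snd i))" and "x = (\<lambda>i. snd (snd i))"
    define U where "U = (\<lambda>i j. cell_average (dx i) (u (t i)) (x i + of_int j * dx i))"
    have mesh: "((\<lambda>i. fst i) \<longlongrightarrow> (0, 0)) G"
      using filterlim_fst[of "at (0, 0) within ?S" "nhds (t0, x0)"]
      unfolding G_def by (rule filterlim_mono) (auto simp: at_within_def)
    have point: "((\<lambda>i. snd i) \<longlongrightarrow> (t0, x0)) G"
      unfolding G_def by (rule filterlim_snd)
    have lim: "(dt \<longlongrightarrow> 0) G" "(dx \<longlongrightarrow> 0) G" "(t \<longlongrightarrow> t0) G" "(x \<longlongrightarrow> x0) G"
      using tendsto_fst[OF mesh] tendsto_snd[OF mesh] tendsto_fst[OF point] tendsto_snd[OF point]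
      by (simp_all add: dt_def dx_def t_def x_def)
    have "\<forall>\<^sub>F h in at (0, 0) within ?S. h \<in> ?S"
      by (simp add: eventually_at_filter)
    then have "\<forall>\<^sub>F i in G. fst i \<in> ?S"
      using filterlim_fst unfolding G_def filterlim_iff by blast
    then have pos: "\<forall>\<^sub>F i in G. 0 < dt i" "\<forall>\<^sub>F i in G. 0 < dx i"
      by (auto elim!: eventually_mono simp: dt_def dx_def)
    have inT: "\<forall>\<^sub>F i in G. \<tau> i \<in> {0<..<T}" if "(\<tau> \<longlongrightarrow> t0) G" for \<tau>
      using topological_tendstoD[OF that _ t0] by simp
    have t_dt: "((\<lambda>i. t i + dt i) \<longlongrightarrow> t0) G"
      using tendsto_add[OF lim(3) lim(1)] by simp
    have lift: "((\<lambda>(i, y). f i) \<longlongrightarrow> l) (G \<times>\<^sub>F nhds x0)" if "(f \<longlongrightarrow> l) G"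
      for f :: "_ \<Rightarrow> real" and l
      using filterlim_compose[OF that filterlim_fst] by (simp add: case_prod_unfold)
    have y: "((\<lambda>(i, y). y) \<longlongrightarrow> x0) (G \<times>\<^sub>F nhds x0)"
      using filterlim_snd by (simp add: case_prod_unfold)
    have liftE: "\<forall>\<^sub>F (i, y) in G \<times>\<^sub>F nhds x0. P i" if "eventually P G" for P
      using that eventually_prodI[OF that always_eventually] filterlim_fst
      unfolding filterlim_iff case_prod_unfold by blast
    have centre: "((\<lambda>i. x i + of_int j * dx i) \<longlongrightarrow> x0) G" for j
      using tendsto_add[OF lim(4) tendsto_mult[OF tendsto_const lim(2)]] by simp
    \<comment> \<open>One limit for both directions: \<open>(a, b) = (0, 1)\<close> with \<open>h = dx\<close> gives the space slopes,
      \<open>(1, 0)\<close> with \<open>h = dt\<close> the time differences.\<close>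
    have quot: "((\<lambda>(i, y). (1 / h i) *\<^sub>R (u (t i + a * h i) (y + b * h i) - u (t i) y)) \<longlongrightarrow> ?D (a, b))
        (G \<times>\<^sub>F nhds x0)" if h: "(h \<longlongrightarrow> 0) G" "\<forall>\<^sub>F i in G. 0 < h i" for h a b
    proof -
      let ?b = "\<lambda>(i, y). (t i + a * h i, y + b * h i)" and ?c = "\<lambda>(i, y). (t i, y)"
      have "(?b \<longlongrightarrow> (t0 + a * 0, x0 + b * 0)) (G \<times>\<^sub>F nhds x0)"
        using lift[OF lim(3)] lift[OF h(1)] y unfolding case_prod_unfold
        by (intro tendsto_intros)
      then have b: "(?b \<longlongrightarrow> (t0, x0)) (G \<times>\<^sub>F nhds x0)" by simp
      have c: "(?c \<longlongrightarrow> (t0, x0)) (G \<times>\<^sub>F nhds x0)"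
        using lift[OF lim(3)] y unfolding case_prod_unfold by (intro tendsto_intros)
      have q: "((\<lambda>z. (1 / h (fst z)) *\<^sub>R (?b z - ?c z)) \<longlongrightarrow> (a, b)) (G \<times>\<^sub>F nhds x0)"
        by (rule tendsto_eventually)
          (use liftE[OF h(2)] in eventually_elim, auto)
      show ?thesis
        using difference_quotient_chain[OF u open_\<Omega> _ b c q] t0 by (simp add: case_prod_unfold)
    qed
    have cells: "((\<lambda>i. U i j) \<longlongrightarrow> u t0 x0) G" for j
      unfolding U_def
    proof (rule cell_average_tendsto[OF _ lim(2) pos(2) centre])
      have "isCont ?u (t0, x0)"
        using D has_derivative_continuous by blast
      moreover have "((\<lambda>(i, y). (t i, y)) \<longlongrightarrow> (t0, x0)) (G \<times>\<^sub>F nhds x0)"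
        using lift[OF lim(3)] y unfolding case_prod_unfold by (intro tendsto_intros)
      ultimately show "((\<lambda>(i, y). u (t i) y) \<longlongrightarrow> u t0 x0) (G \<times>\<^sub>F nhds x0)"
        using isCont_tendsto_compose by (fastforce simp: case_prod_unfold)
      show "\<forall>\<^sub>F i in G. continuous_on UNIV (u (t i))"
        using inT[OF lim(3)] by eventually_elim (use contx[of _ 0] in simp)
    qed
    have slopes: "((\<lambda>i. (1 / dx i) *\<^sub>R (U i (j + 1) - U i j)) \<longlongrightarrow> ?D (0, 1)) G" for j
    proof (rule Lim_transform_eventually)
      let ?\<phi> = "\<lambda>i y. (1 / dx i) *\<^sub>R (u (t i) (y + dx i) - u (t i) y)"
      show "((\<lambda>i. cell_average (dx i) (?\<phi> i) (x i + of_int j * dx i)) \<longlongrightarrow> ?D (0, 1)) G"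
      proof (rule cell_average_tendsto[OF _ lim(2) pos(2) centre])
        show "((\<lambda>(i, y). ?\<phi> i y) \<longlongrightarrow> ?D (0, 1)) (G \<times>\<^sub>F nhds x0)"
          using quot[OF lim(2) pos(2), of 0 1] by simp
        show "\<forall>\<^sub>F i in G. continuous_on UNIV (?\<phi> i)"
          using inT[OF lim(3)]
          by eventually_elim (use contx contx[of _ 0] in \<open>auto intro!: continuous_intros\<close>)
      qed
      show "\<forall>\<^sub>F i in G. cell_average (dx i) (?\<phi> i) (x i + of_int j * dx i) =
          (1 / dx i) *\<^sub>R (U i (j + 1) - U i j)"
        using inT[OF lim(3)]
      proof eventually_elim
        case (elim i)
        have "U i (j + 1) = cell_average (dx i) (\<lambda>y. u (t i) (y + dx i)) (x i + of_int j * dx i)"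
          using cell_average_shift[of "dx i" "u (t i)" "x i + of_int j * dx i" "dx i"]
          by (simp add: U_def algebra_simps)
        then show ?case
          unfolding U_def
          using cell_average_difference[OF contx[OF elim, of "dx i"] contx[OF elim, of 0]]
          by (simp add: algebra_simps)
      qed
    qed
    have time: "((\<lambda>i. (1 / dt i) *\<^sub>R (cell_average (dx i) (u (t i + dt i)) (x i) - U i 0)) \<longlongrightarrow> ?D (1, 0)) G"
    proof (rule Lim_transform_eventually)
      let ?\<phi> = "\<lambda>i y. (1 / dt i) *\<^sub>R (u (t i + dt i) y - u (t i) y)"
      show "((\<lambda>i. cell_average (dx i) (?\<phi> i) (x i)) \<longlongrightarrow> ?D (1, 0)) G"
      proof (rule cell_average_tendsto[OF _ lim(2) pos(2) lim(4)])
        show "((\<lambda>(i, y). ?\<phi> i y) \<longlongrightarrow> ?D (1, 0)) (G \<times>\<^sub>F nhds x0)"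
          using quot[OF lim(1) pos(1), of 1 0] by simp
        show "\<forall>\<^sub>F i in G. continuous_on UNIV (?\<phi> i)"
          using inT[OF lim(3)] inT[OF t_dt]
          by eventually_elim (use contx[of _ 0] in \<open>auto intro!: continuous_intros\<close>)
      qed
      show "\<forall>\<^sub>F i in G. cell_average (dx i) (?\<phi> i) (x i) =
          (1 / dt i) *\<^sub>R (cell_average (dx i) (u (t i + dt i)) (x i) - U i 0)"
        using inT[OF lim(3)] inT[OF t_dt]
      proof eventually_elim
        case (elim i)
        show ?case
          using cell_average_difference[OF contx[OF elim(2), of 0] contx[OF elim(1), of 0]]
          by (simp add: U_def)
      qed
    qed
    have inA: "\<forall>\<^sub>F i in G. 0 < dt i \<and> 0 < dx i \<and> (\<forall>j. U i j \<in> A)"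
      using pos inT[OF lim(3)]
    proof eventually_elim
      case (elim i)
      have "U i j \<in> A" for j
        unfolding U_def
        using elim contx[OF elim(3), of 0] uA
        by (intro cell_average_in_convex A) (auto intro: continuous_on_subset)
      then show ?case using elim by simp
    qed
    have "((\<lambda>i. (1 / dt i) *\<^sub>R (cell_average (dx i) (u (t i + dt i)) (x i) - U i 0)
        - (1 / dt i) *\<^sub>R (step (dt i) (dx i) (U i) 0 - U i 0)) \<longlongrightarrow>
        ?D (1, 0) - (s (u t0 x0) - g' (u t0 x0) (?D (0, 1)))) G"
      using uA t0 by (intro tendsto_diff time step lim inA cells slopes) auto
    moreover have "?D (1, 0) - (s (u t0 x0) - g' (u t0 x0) (?D (0, 1))) = 0"
      using pde[OF t0, of x0] unfolding ut ux by (simp add: eq_diff_eq)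
    moreover have "(1 / dt i) *\<^sub>R (cell_average (dx i) (u (t i + dt i)) (x i) - U i 0)
        - (1 / dt i) *\<^sub>R (step (dt i) (dx i) (U i) 0 - U i 0) =
        truncation_error step u (dt i) (dx i) (t i) (x i)" for i
      by (simp add: truncation_error_def U_def scaleR_diff_right[symmetric])
    ultimately show "((\<lambda>(h, q). (case h of (dt, dx) \<Rightarrow> \<lambda>(t, x). truncation_error step u dt dx t x) q)
        \<longlongrightarrow> 0) ((at (0, 0) within ?S) \<times>\<^sub>F nhds p)"
      unfolding p G_def[symmetric] by (simp add: case_prod_unfold dt_def dx_def t_def x_def)
  qed
qed

section \<open>The HLL scheme\<close>

lemma hll_flux_same: "sl \<noteq> sr \<Longrightarrow> hll_flux g sl sr v v = g v"
  by (simp add: hll_flux_def scaleR_diff_left[symmetric])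

text \<open>The flux difference is a combination of two difference quotients of \<open>g\<close>, with weights \<open>sr\<close> and
\<open>-sl\<close> that add up to the denominator \<open>sr - sl\<close>, and of the difference of two consecutive slopes. The
latter is the numerical viscosity and vanishes in the limit. The difference-quotient rule for \<open>g\<close> is
a hypothesis, since the equilibrium flux obtains it from its factors.\<close>

lemma hll_consistent:
  fixes g :: "'v::euclidean_space \<Rightarrow> 'v"
  assumes A: "convex A" and s: "sl \<noteq> sr"
    and deriv: "\<And>v. v \<in> A \<Longrightarrow> (g has_derivative g' v) (at v)"
    and quot: "\<And>(G :: ((real \<times> real) \<times> (real \<times> real)) filter) h b c v w.
      v \<in> A \<Longrightarrow> (b \<longlongrightarrow> v) G \<Longrightarrow> (c \<longlongrightarrow> v) G \<Longrightarrow>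
      ((\<lambda>i. (1 / h i) *\<^sub>R (b i - c i)) \<longlongrightarrow> w) G \<Longrightarrow>
      ((\<lambda>i. (1 / h i) *\<^sub>R (g (b i) - g (c i))) \<longlongrightarrow> g' v w) G"
  shows "fv_consistent A g (\<lambda>_. 0) \<mu> (\<lambda>_. hll_flux g sl sr) (hll_step g sl sr)"
proof (rule fv_consistentI[OF A _ deriv])
  show "((\<lambda>dt. hll_flux g sl sr v v) \<longlongrightarrow> g v) (at_right 0)" for v
    by (simp add: hll_flux_same[OF s])
  fix G :: "((real \<times> real) \<times> (real \<times> real)) filter" and dt dx :: "_ \<Rightarrow> real"
    and U :: "(real \<times> real) \<times> (real \<times> real) \<Rightarrow> int \<Rightarrow> 'v" and v w
  assume v: "v \<in> A" and pos: "\<forall>\<^sub>F i in G. 0 < dt i \<and> 0 < dx i \<and> (\<forall>j. U i j \<in> A)"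
    and U: "\<And>j. ((\<lambda>i. U i j) \<longlongrightarrow> v) G"
    and w: "\<And>j. ((\<lambda>i. (1 / dx i) *\<^sub>R (U i (j + 1) - U i j)) \<longlongrightarrow> w) G"
  define q where "q = (\<lambda>j i. (1 / dx i) *\<^sub>R (U i (j + 1) - U i j))"
  define qg where "qg = (\<lambda>j i. (1 / dx i) *\<^sub>R (g (U i (j + 1)) - g (U i j)))"
  have q: "(q j \<longlongrightarrow> w) G" for j
    unfolding q_def by (rule w)
  have qg: "(qg j \<longlongrightarrow> g' v w) G" for j
    unfolding qg_def by (rule quot[OF v U U w])
  have "((\<lambda>i. - ((1 / (sr - sl)) *\<^sub>R (sr *\<^sub>R qg (-1) i - sl *\<^sub>R qg 0 i
      + (sr * sl) *\<^sub>R (q 0 i - q (-1) i)))) \<longlongrightarrow>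
      - ((1 / (sr - sl)) *\<^sub>R (sr *\<^sub>R g' v w - sl *\<^sub>R g' v w + (sr * sl) *\<^sub>R (w - w)))) G"
    by (intro tendsto_intros q qg)
  moreover have "- ((1 / (sr - sl)) *\<^sub>R (sr *\<^sub>R g' v w - sl *\<^sub>R g' v w + (sr * sl) *\<^sub>R (w - w)))
      = 0 - g' v w"
    using s by (simp add: scaleR_diff_left[symmetric])
  moreover have "\<forall>\<^sub>F i in G. - ((1 / (sr - sl)) *\<^sub>R (sr *\<^sub>R qg (-1) i - sl *\<^sub>R qg 0 i
      + (sr * sl) *\<^sub>R (q 0 i - q (-1) i))) =
      (1 / dt i) *\<^sub>R (hll_step g sl sr (dt i) (dx i) (U i) 0 - U i 0)"
    using pos
  proof eventually_elim
    case (elim i)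
    then have "(1 / dt i) * (dt i / dx i) = 1 / dx i" by simp
    then have "(1 / dt i) *\<^sub>R (hll_step g sl sr (dt i) (dx i) (U i) 0 - U i 0) =
        - ((1 / dx i) *\<^sub>R (hll_flux g sl sr (U i 0) (U i 1) - hll_flux g sl sr (U i (-1)) (U i 0)))"
      by (simp add: hll_step_def)
    also have "hll_flux g sl sr (U i 0) (U i 1) - hll_flux g sl sr (U i (-1)) (U i 0) =
        (1 / (sr - sl)) *\<^sub>R (sr *\<^sub>R (g (U i 0) - g (U i (-1))) - sl *\<^sub>R (g (U i 1) - g (U i 0))
          + (sr * sl) *\<^sub>R ((U i 1 - U i 0) - (U i 0 - U i (-1))))"
      unfolding hll_flux_def scaleR_diff_right[symmetric]
      by (rule arg_cong[where f = "scaleR _"]) (simp add: algebra_simps)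
    also have "(1 / dx i) *\<^sub>R \<dots> = (1 / (sr - sl)) *\<^sub>R (sr *\<^sub>R qg (-1) i - sl *\<^sub>R qg 0 i
      + (sr * sl) *\<^sub>R (q 0 i - q (-1) i))"
      by (simp add: q_def qg_def scaleR_diff_right scaleR_add_right mult.commute)
    finally show ?case by simp
  qed
  ultimately show "((\<lambda>i. (1 / dt i) *\<^sub>R (hll_step g sl sr (dt i) (dx i) (U i) 0 - U i 0))
      \<longlongrightarrow> 0 - g' v w) G"
    using Lim_transform_eventually by fastforce
qed

text \<open>The HLL flux can be read off either side of the Riemann fan, as the flux of the left state plus the
jump across the left wave or as the flux of the right state plus the jump across the right wave. In
the update of a cell the right interface is read from its left side and the left one from its right
side, and the flux of the cell itself cancels.\<close>

lemma hll_step_convex_combination: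
  assumes "sl \<noteq> sr"
  shows "hll_step g sl sr dt dx V j =
    (1 - dt / dx * (sr - sl)) *\<^sub>R V j + (- (dt / dx) * sl) *\<^sub>R hll_middle g sl sr (V j) (V (j + 1))
      + (dt / dx * sr) *\<^sub>R hll_middle g sl sr (V (j - 1)) (V j)"
proof -
  define r where "r = dt / dx"
  have left: "hll_flux g sl sr a b = g a + sl *\<^sub>R (hll_middle g sl sr a b - a)" for a b
  proof -
    have flux: "(sr - sl) *\<^sub>R hll_flux g sl sr a b =
        sr *\<^sub>R g a - sl *\<^sub>R g b + (sr * sl) *\<^sub>R (b - a)"
      using assms by (simp add: hll_flux_def)
    have middle: "(sr - sl) *\<^sub>R hll_middle g sl sr a b = sr *\<^sub>R b - sl *\<^sub>R a - (g b - g a)"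
      using assms by (simp add: hll_middle_def)
    have "(sr - sl) *\<^sub>R (g a + sl *\<^sub>R (hll_middle g sl sr a b - a)) =
        (sr - sl) *\<^sub>R g a + sl *\<^sub>R ((sr - sl) *\<^sub>R hll_middle g sl sr a b - (sr - sl) *\<^sub>R a)"
      by (simp add: algebra_simps)
    also have "\<dots> = (sr - sl) *\<^sub>R hll_flux g sl sr a b"
      unfolding middle flux by (simp add: algebra_simps)
    finally have "(sr - sl) *\<^sub>R hll_flux g sl sr a b =
        (sr - sl) *\<^sub>R (g a + sl *\<^sub>R (hll_middle g sl sr a b - a))" ..
    then show ?thesis using assms by simp
  qed
  have right: "hll_flux g sl sr a b = g b + sr *\<^sub>R (hll_middle g sl sr a b - b)" for a b
  proof -
    have "(sr - sl) *\<^sub>R hll_middle g sl sr a b = sr *\<^sub>R b - sl *\<^sub>R a - (g b - g a)"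
      using assms by (simp add: hll_middle_def)
    then have "sr *\<^sub>R hll_middle g sl sr a b - sl *\<^sub>R hll_middle g sl sr a b =
        sr *\<^sub>R b - sl *\<^sub>R a - (g b - g a)"
      by (simp add: scaleR_diff_left)
    then show ?thesis
      unfolding left by (simp add: algebra_simps)
  qed
  have "hll_step g sl sr dt dx V j =
      V j - r *\<^sub>R (sl *\<^sub>R (hll_middle g sl sr (V j) (V (j + 1)) - V j)
        - sr *\<^sub>R (hll_middle g sl sr (V (j - 1)) (V j) - V j))"
    unfolding hll_step_def left[of "V j"] right[of _ "V j"] r_def by simp
  then show ?thesis
    unfolding r_def[symmetric] by (simp add: algebra_simps)
qed

text \<open>Under the CFL condition the three weights of \<open>hll_step_convex_combination\<close> are nonnegative: each of
\<open>- dt / dx * sl\<close> and \<open>dt / dx * sr\<close> is at most one half.\<close>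

lemma hll_stable_of_CFL:
  fixes g :: "'v::real_vector \<Rightarrow> 'v"
  assumes s: "sl < 0" "0 < sr" and d: "0 < dt" "0 < dx"
    and CFL: "dt / dx * max \<bar>sl\<bar> \<bar>sr\<bar> \<le> 1 / 2"
  shows "hll_stable A g sl sr dt dx"
  unfolding hll_stable_def
proof (intro allI impI)
  fix D :: "'v set" and V :: "int \<Rightarrow> 'v" and j
  assume *: "convex D \<and> D \<subseteq> A \<and> (\<forall>j. V j \<in> D) \<and> (\<forall>j. hll_middle g sl sr (V j) (V (j + 1)) \<in> D)"
  define r where "r = dt / dx"
  have r: "0 < r" "r * max \<bar>sl\<bar> \<bar>sr\<bar> \<le> 1 / 2"
    using d CFL by (simp_all add: r_def)
  have "r * \<bar>sl\<bar> \<le> r * max \<bar>sl\<bar> \<bar>sr\<bar>" "r * \<bar>sr\<bar> \<le> r * max \<bar>sl\<bar> \<bar>sr\<bar>"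
    using r by (auto intro!: mult_left_mono)
  then have half: "- (r * sl) \<le> 1 / 2" "r * sr \<le> 1 / 2"
    using r(2) s by auto
  have nn: "0 \<le> - r * sl" "0 \<le> r * sr" "0 \<le> 1 - r * (sr - sl)"
    using half r s by (auto simp: right_diff_distrib mult_nonneg_nonpos)
  define c where "c = (\<lambda>i::nat. if i = 0 then 1 - r * (sr - sl) else if i = 1 then - r * sl else r * sr)"
  define y where "y = (\<lambda>i::nat. if i = 0 then V j else if i = 1 then hll_middle g sl sr (V j) (V (j + 1))
    else hll_middle g sl sr (V (j - 1)) (V j))"
  have "(\<Sum>i\<in>{0,1,2}. c i *\<^sub>R y i) \<in> D"
  proof (rule convex_sum)
    have "hll_middle g sl sr (V (j - 1)) (V (j - 1 + 1)) \<in> D"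
      using * by blast
    then show "y i \<in> D" for i
      using * by (auto simp: y_def)
    show "sum c {0, 1, 2} = 1"
      by (simp add: c_def algebra_simps)
  qed (use * nn in \<open>auto simp: c_def\<close>)
  then show "hll_step g sl sr dt dx V j \<in> D"
    using s by (simp add: hll_step_convex_combination c_def y_def r_def algebra_simps)
qed

section \<open>The relaxation scheme\<close>

lemma smooth_near_ck1:
  assumes "smooth_near A g" "p \<in> A"
  obtains N where "open N" "p \<in> N" "ck_on 1 g N"
proof -
  obtain N where "open N" "A \<subseteq> N" "\<forall>k. ck_on k g N"
    using assms(1) by (auto simp only: smooth_near_def)
  then show thesis using assms(2) that by (meson subsetD)
qed

text \<open>A two-point flux built from the jump of a quantity \<open>x\<close> and a weighted difference of values \<open>y\<close>
contributes to a cell only through difference quotients: \<open>x1 - x0\<close>, \<open>x0 - x'\<close> are the jumps of \<open>x\<close>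
at the two interfaces.\<close>

lemma flux_balance_quotients:
  fixes x' x0 x1 y' y0 y1 :: "'v::real_vector"
  shows "d *\<^sub>R ((a *\<^sub>R (x1 - x0) - b *\<^sub>R (l *\<^sub>R y1 - r *\<^sub>R y0))
      - (a *\<^sub>R (x0 - x') - b *\<^sub>R (l *\<^sub>R y0 - r *\<^sub>R y'))) =
    a *\<^sub>R (d *\<^sub>R (x1 - x0) - d *\<^sub>R (x0 - x'))
      - b *\<^sub>R (l *\<^sub>R (d *\<^sub>R (y1 - y0)) - r *\<^sub>R (d *\<^sub>R (y0 - y')))"
  by (simp add: algebra_simps)

text \<open>Smoothness makes the difference-quotient rule available for \<open>f\<close> and \<open>Q\<close>; the remaining conditions
on the system make the relaxation ODE explicitly solvable inside \<open>K\<close>.\<close>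

locale relaxation_scheme =
  fixes K :: "(real^'n) set"
    and f R :: "real^'n \<Rightarrow> real^'n"
    and Q :: "real^'k \<Rightarrow> real^'m"
    and M1 :: "real^'n^'k"
    and M2 :: "real^'n^'m"
    and sl sr :: real
  assumes inv: "invertible (vstack M1 M2)"
    and K: "convex K"
    and smooth_f: "smooth_near K f"
    and smooth_Q: "smooth_near UNIV Q"
    and R1: "\<forall>W\<in>K. M1 *v R W = 0"
    and R2: "\<forall>W\<in>K. M2 *v R W = Q (M1 *v W) - M2 *v W"
    and equilibrium: "\<forall>W\<in>K. state M1 M2 (M1 *v W, Q (M1 *v W)) \<in> K"
    and speeds: "sl \<noteq> sr"
begin

abbreviation S :: "(real^'k) \<times> (real^'m) \<Rightarrow> real^'n" where
  "S \<equiv> state M1 M2"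

abbreviation Df :: "real^'n \<Rightarrow> real^'n \<Rightarrow> real^'n" where
  "Df W \<equiv> frechet_derivative f (at W)"

abbreviation DQ :: "real^'k \<Rightarrow> real^'k \<Rightarrow> real^'m" where
  "DQ V \<equiv> frechet_derivative Q (at V)"

lemma wave_speeds_cancel: "(1 / (sr - sl)) *\<^sub>R (sl *\<^sub>R x - sr *\<^sub>R x) = - x" for x :: "'v::real_vector"
proof -
  have "(1 / (sr - sl)) *\<^sub>R (sl *\<^sub>R x - sr *\<^sub>R x) = ((sl - sr) / (sr - sl)) *\<^sub>R x"
    by (simp add: scaleR_diff_left[symmetric])
  also have "(sl - sr) / (sr - sl) = -1"
    using speeds by (simp add: field_simps)
  finally show ?thesis by simp
qed

lemma bounded_linear_state: "bounded_linear S"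
proof -
  have "linear S"
  proof (rule linearI)
    show "S (x + y) = S x + S y" for x y
    proof -
      have "vstack (fst x + fst y) (snd x + snd y) = vstack (fst x) (snd x) + vstack (fst y) (snd y)"
        by (auto simp: vec_eq_iff vstack_def split: sum.splits)
      then show ?thesis by (simp add: state_def matrix_vector_right_distrib)
    qed
    show "S (a *\<^sub>R x) = a *\<^sub>R S x" for a x
    proof -
      have "vstack (a *\<^sub>R fst x) (a *\<^sub>R snd x) = a *\<^sub>R vstack (fst x) (snd x)"
        by (auto simp: vec_eq_iff vstack_def split: sum.splits)
      then show ?thesis by (simp add: state_def matrix_vector_mult_scaleR)
    qed
  qed
  then show ?thesis by (simp add: linear_conv_bounded_linear)
qed

lemma state_conserved_relaxed: "M1 *v S v = fst v" "M2 *v S v = snd v"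
  using state_components[OF inv, of "S v" "fst v" "snd v"] by simp_all

lemma equilibrium_in_K: "S (fst v, Q (fst v)) \<in> K" if "S v \<in> K"
  using equilibrium[rule_format, OF that] by (simp add: state_conserved_relaxed)

lemma has_derivative_f: "(f has_derivative Df W) (at W)" if "W \<in> K"
proof -
  obtain N where "W \<in> N" "ck_on 1 f N"
    using smooth_near_ck1[OF smooth_f \<open>W \<in> K\<close>] .
  then show ?thesis using ck1_has_derivative by blast
qed

lemma has_derivative_Q: "(Q has_derivative DQ V) (at V)"
proof -
  obtain N where "V \<in> N" "ck_on 1 Q N"
    using smooth_near_ck1[OF smooth_Q UNIV_I[of V]] .
  then show ?thesis using ck1_has_derivative by blast
qed

lemma quotient_f:
  assumes "W \<in> K" "(b \<longlongrightarrow> W) F" "(c \<longlongrightarrow> W) F"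
    and "((\<lambda>i. (1 / h i) *\<^sub>R (b i - c i)) \<longlongrightarrow> w) F"
  shows "((\<lambda>i. (1 / h i) *\<^sub>R (f (b i) - f (c i))) \<longlongrightarrow> Df W w) F"
proof -
  obtain N where "open N" "W \<in> N" "ck_on 1 f N"
    using smooth_near_ck1[OF smooth_f \<open>W \<in> K\<close>] .
  then show ?thesis using difference_quotient_chain assms by blast
qed

lemma quotient_Q:
  assumes "(b \<longlongrightarrow> V) F" "(c \<longlongrightarrow> V) F"
    and "((\<lambda>i. (1 / h i) *\<^sub>R (b i - c i)) \<longlongrightarrow> w) F"
  shows "((\<lambda>i. (1 / h i) *\<^sub>R (Q (b i) - Q (c i))) \<longlongrightarrow> DQ V w) F"
proof -
  obtain N where "open N" "V \<in> N" "ck_on 1 Q N"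
    using smooth_near_ck1[OF smooth_Q UNIV_I[of V]] .
  then show ?thesis using difference_quotient_chain assms by blast
qed

lemma quotient_linear:
  assumes L: "bounded_linear L" and "((\<lambda>i. (1 / h i) *\<^sub>R (b i - c i)) \<longlongrightarrow> w) F"
  shows "((\<lambda>i. (1 / h i) *\<^sub>R (L (b i) - L (c i))) \<longlongrightarrow> L w) F"
  using bounded_linear.tendsto[OF assms]
  by (simp only: linear_cmul[OF bounded_linear.linear[OF L]] linear_diff[OF bounded_linear.linear[OF L]])

lemma tendsto_Q: "(b \<longlongrightarrow> V) F \<Longrightarrow> ((\<lambda>i. Q (b i)) \<longlongrightarrow> Q V) F"
  using isCont_tendsto_compose[OF has_derivative_continuous[OF has_derivative_Q]] by blast

lemma tendsto_f: "W \<in> K \<Longrightarrow> (b \<longlongrightarrow> W) F \<Longrightarrow> ((\<lambda>i. f (b i)) \<longlongrightarrow> f W) F"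
  using isCont_tendsto_compose[OF has_derivative_continuous[OF has_derivative_f]] by blast

lemma relax_flow_state:
  assumes "S v \<in> K" "\<epsilon> > 0" "t \<ge> 0"
  shows "relax_flow K R \<epsilon> (S v) t =
    S (fst v, Q (fst v)) + exp (- t / \<epsilon>) *\<^sub>R (S v - S (fst v, Q (fst v)))"
  using relax_flow_eq(3)[OF inv K assms(1) R1 R2 equilibrium assms(2,3)] by (simp add: state_conserved_relaxed)

text \<open>The relaxation flow moves a state exponentially towards equilibrium, so over a vanishing time step
at fixed \<open>\<epsilon>\<close> it is the identity in the limit.\<close>

lemma relax_flow_tendsto:
  assumes \<epsilon>: "\<epsilon> > 0" and dt: "(dt \<longlongrightarrow> 0) F" and b: "(b \<longlongrightarrow> v) F"
    and ev: "\<forall>\<^sub>F i in F. 0 < dt i \<and> S (b i) \<in> K"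
  shows "((\<lambda>i. relax_flow K R \<epsilon> (S (b i)) (dt i)) \<longlongrightarrow> S v) F"
proof (rule Lim_transform_eventually)
  let ?p = "\<lambda>v. S (fst v, Q (fst v))"
  have "((\<lambda>i. ?p (b i) + exp (- dt i / \<epsilon>) *\<^sub>R (S (b i) - ?p (b i))) \<longlongrightarrow>
      ?p v + exp (- 0 / \<epsilon>) *\<^sub>R (S v - ?p v)) F"
    using \<epsilon> by (intro tendsto_intros bounded_linear.tendsto[OF bounded_linear_state] tendsto_Q b dt) auto
  then show "((\<lambda>i. ?p (b i) + exp (- dt i / \<epsilon>) *\<^sub>R (S (b i) - ?p (b i))) \<longlongrightarrow> S v) F"
    by simp
  show "\<forall>\<^sub>F i in F. ?p (b i) + exp (- dt i / \<epsilon>) *\<^sub>R (S (b i) - ?p (b i)) =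
      relax_flow K R \<epsilon> (S (b i)) (dt i)"
    using ev by eventually_elim (simp add: relax_flow_state \<epsilon>)
qed

text \<open>The flow tends to the identity together with its derivative: it is a combination, with weights
\<open>1 - exp (- dt / \<epsilon>)\<close> and \<open>exp (- dt / \<epsilon>)\<close>, of the equilibrium map and the identity, both of which
have convergent difference quotients, and the first weight vanishes.\<close>

lemma relax_flow_quotient:
  assumes \<epsilon>: "\<epsilon> > 0" and dt: "(dt \<longlongrightarrow> 0) F" and b: "(b \<longlongrightarrow> v) F" and c: "(c \<longlongrightarrow> v) F"
    and ev: "\<forall>\<^sub>F i in F. 0 < dt i \<and> S (b i) \<in> K \<and> S (c i) \<in> K"
    and q: "((\<lambda>i. (1 / h i) *\<^sub>R (b i - c i)) \<longlongrightarrow> w) F"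
  shows "((\<lambda>i. (1 / h i) *\<^sub>R (relax_flow K R \<epsilon> (S (b i)) (dt i) - relax_flow K R \<epsilon> (S (c i)) (dt i)))
    \<longlongrightarrow> S w) F"
proof (rule Lim_transform_eventually)
  let ?p = "\<lambda>v. (fst v, Q (fst v))" and ?E = "\<lambda>i. exp (- dt i / \<epsilon>)"
  let ?q = "\<lambda>i. (1 / h i) *\<^sub>R (S (b i) - S (c i))"
  let ?qp = "\<lambda>i. (1 / h i) *\<^sub>R (S (?p (b i)) - S (?p (c i)))"
  have q1: "((\<lambda>i. (1 / h i) *\<^sub>R (fst (b i) - fst (c i))) \<longlongrightarrow> fst w) F"
    using q by (rule quotient_linear[OF bounded_linear_fst])
  have "((\<lambda>i. (1 / h i) *\<^sub>R (?p (b i) - ?p (c i))) \<longlongrightarrow> (fst w, DQ (fst v) (fst w))) F"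
    using tendsto_Pair[OF q1 quotient_Q[OF tendsto_fst[OF b] tendsto_fst[OF c] q1]] by simp
  then have qp: "(?qp \<longlongrightarrow> S (fst w, DQ (fst v) (fst w))) F"
    by (rule quotient_linear[OF bounded_linear_state])
  have qS: "(?q \<longlongrightarrow> S w) F"
    using q by (rule quotient_linear[OF bounded_linear_state])
  have "((\<lambda>i. ?qp i + ?E i *\<^sub>R (?q i - ?qp i)) \<longlongrightarrow> S (fst w, DQ (fst v) (fst w)) +
      exp (- 0 / \<epsilon>) *\<^sub>R (S w - S (fst w, DQ (fst v) (fst w)))) F"
    using \<epsilon> by (intro tendsto_intros qS qp dt) auto
  then show "((\<lambda>i. ?qp i + ?E i *\<^sub>R (?q i - ?qp i)) \<longlongrightarrow> S w) F"
    by simp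
  show "\<forall>\<^sub>F i in F. ?qp i + ?E i *\<^sub>R (?q i - ?qp i) =
      (1 / h i) *\<^sub>R (relax_flow K R \<epsilon> (S (b i)) (dt i) - relax_flow K R \<epsilon> (S (c i)) (dt i))"
    using ev
  proof eventually_elim
    case (elim i)
    have "d *\<^sub>R (a + e *\<^sub>R (s - a) - (b + e *\<^sub>R (t - b))) =
        d *\<^sub>R (a - b) + e *\<^sub>R (d *\<^sub>R (s - t) - d *\<^sub>R (a - b))"
      for a b s t :: "real^'n" and d e :: real
      by (simp add: algebra_simps)
    then show ?case
      using elim by (simp only: relax_flow_state \<epsilon> less_imp_le)
  qed
qed

lemma exp_quotient:
  fixes dt :: "'i \<Rightarrow> real"
  assumes "\<epsilon> > 0" "(dt \<longlongrightarrow> 0) F" "\<forall>\<^sub>F i in F. 0 < dt i"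
  shows "((\<lambda>i. (exp (- dt i / \<epsilon>) - 1) / dt i) \<longlongrightarrow> - (1 / \<epsilon>)) F"
proof -
  have "((\<lambda>t::real. exp (- t / \<epsilon>)) has_real_derivative - (1 / \<epsilon>)) (at 0)"
    using assms(1) by (auto intro!: derivative_eq_intros)
  then have "((\<lambda>h. (exp (- h / \<epsilon>) - 1) / h) \<longlongrightarrow> - (1 / \<epsilon>)) (at 0)"
    by (simp add: DERIV_def)
  moreover have "filterlim dt (at 0) F"
    using assms(2,3) by (auto simp: filterlim_at elim: eventually_mono)
  ultimately show ?thesis
    by (rule filterlim_compose)
qed

text \<open>At fixed \<open>\<epsilon>\<close> the factors \<open>exp (- dt / \<epsilon>)\<close> and \<open>\<epsilon> * (exp (- dt / \<epsilon>) - 1) / dt\<close> of the second flux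
tend to \<open>1\<close> and \<open>-1\<close>, so that both numerical fluxes become the HLL flux of the original system,
and \<open>(1 - exp (- dt / \<epsilon>)) / dt\<close> tends to the relaxation rate \<open>1 / \<epsilon>\<close> of the source. The source is
evaluated at the updated first component, which differs from the old one by \<open>dt\<close> times the bounded
quantity \<open>X\<close>.\<close>

lemma ar_consistent:
  assumes \<epsilon>: "\<epsilon> > 0"
  shows "fv_consistent {u. S u \<in> K} (\<lambda>u. (M1 *v f (S u), M2 *v f (S u)))
    (\<lambda>u. (0, (1 / \<epsilon>) *\<^sub>R (M2 *v R (S u)))) \<mu>
    (ar_flux K f R M1 M2 sl sr \<epsilon>) (ar_step K f R Q M1 M2 sl sr \<epsilon>)"
proof (rule fv_consistentI[where g' = "\<lambda>v w. (M1 *v Df (S v) (S w), M2 *v Df (S v) (S w))"])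
  have "convex (S -` K)"
    using bounded_linear.linear[OF bounded_linear_state] K by (rule convex_linear_vimage)
  then show "convex {u. S u \<in> K}" by (simp add: vimage_def)
next
  fix v assume "v \<in> {u. S u \<in> K}"
  then have v: "S v \<in> K" by simp
  let ?W = "\<lambda>dt. relax_flow K R \<epsilon> (S v) dt"
  have dt: "((\<lambda>dt. dt) \<longlongrightarrow> 0) (at_right (0::real))" "\<forall>\<^sub>F dt in at_right (0::real). 0 < dt"
    by (auto simp: eventually_at_filter)
  have W: "((\<lambda>dt. f (?W dt)) \<longlongrightarrow> f (S v)) (at_right 0)"
    using dt v by (intro tendsto_f relax_flow_tendsto[OF \<epsilon>]) (auto elim: eventually_mono)
  have lin: "((\<lambda>dt. M *v f (?W dt)) \<longlongrightarrow> M *v f (S v)) (at_right 0)" for M :: "real^'n^'l"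
    using W by (rule bounded_linear.tendsto[OF matrix_vector_mul_bounded_linear])
  have flux1: "ar_flux1 K f R M1 M2 sl sr \<epsilon> dt v v = M1 *v f (?W dt)" for dt
    using wave_speeds_cancel[of "M1 *v f (?W dt)"] by (simp add: ar_flux1_def)
  have flux2: "ar_flux2 K f R M1 M2 sl sr \<epsilon> dt v v = (- \<epsilon> * ((exp (- dt / \<epsilon>) - 1) / dt)) *\<^sub>R (M2 *v f (?W dt))" for dt
  proof -
    let ?c = "\<epsilon> * ((exp (- dt / \<epsilon>) - 1) / dt)" and ?x = "M2 *v f (?W dt)"
    have "ar_flux2 K f R M1 M2 sl sr \<epsilon> dt v v = (?c * (1 / (sr - sl))) *\<^sub>R (sl *\<^sub>R ?x - sr *\<^sub>R ?x)"
      by (simp add: ar_flux2_def)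
    also have "\<dots> = ?c *\<^sub>R (- ?x)"
      unfolding scaleR_scaleR[symmetric] wave_speeds_cancel ..
    finally show ?thesis by simp
  qed
  have "((\<lambda>dt. (- \<epsilon> * ((exp (- dt / \<epsilon>) - 1) / dt)) *\<^sub>R (M2 *v f (?W dt))) \<longlongrightarrow>
      (- \<epsilon> * (- (1 / \<epsilon>))) *\<^sub>R (M2 *v f (S v))) (at_right 0)"
    using dt by (intro tendsto_intros exp_quotient[OF \<epsilon>] lin)
  then show "((\<lambda>dt. ar_flux K f R M1 M2 sl sr \<epsilon> dt v v) \<longlongrightarrow> (M1 *v f (S v), M2 *v f (S v))) (at_right 0)"
    unfolding ar_flux_def flux1 flux2 using \<epsilon> by (intro tendsto_Pair lin) simp
next
  fix v assume "v \<in> {u. S u \<in> K}"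
  then have "((\<lambda>u. f (S u)) has_derivative (\<lambda>w. Df (S v) (S w))) (at v)"
    by (intro has_derivative_compose[OF bounded_linear_imp_has_derivative[OF bounded_linear_state]]
        has_derivative_f) simp
  then show "((\<lambda>u. (M1 *v f (S u), M2 *v f (S u))) has_derivative
      (\<lambda>w. (M1 *v Df (S v) (S w), M2 *v Df (S v) (S w)))) (at v)"
    by (intro has_derivative_Pair bounded_linear.has_derivative[OF matrix_vector_mul_bounded_linear])
next
  fix G :: "((real \<times> real) \<times> (real \<times> real)) filter" and dt dx :: "_ \<Rightarrow> real"
    and U :: "(real \<times> real) \<times> (real \<times> real) \<Rightarrow> int \<Rightarrow> (real^'k) \<times> (real^'m)" and v w
  assume vA: "v \<in> {u. S u \<in> K}" and dt: "(dt \<longlongrightarrow> 0) G" and dx: "(dx \<longlongrightarrow> 0) G"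
    and ev: "\<forall>\<^sub>F i in G. 0 < dt i \<and> 0 < dx i \<and> (\<forall>j. U i j \<in> {u. S u \<in> K})"
    and U: "\<And>j. ((\<lambda>i. U i j) \<longlongrightarrow> v) G"
    and w: "\<And>j. ((\<lambda>i. (1 / dx i) *\<^sub>R (U i (j + 1) - U i j)) \<longlongrightarrow> w) G"
  have v: "S v \<in> K" using vA by simp
  let ?E = "\<lambda>i. exp (- dt i / \<epsilon>)"
  define \<phi> where "\<phi> = (\<lambda>i j. f (relax_flow K R \<epsilon> (S (U i j)) (dt i)))"
  define q1 where "q1 = (\<lambda>i (j::int). (1 / dx i) *\<^sub>R (fst (U i (j + 1)) - fst (U i j)))"
  define q2 where "q2 = (\<lambda>i (j::int). (1 / dx i) *\<^sub>R (snd (U i (j + 1)) - snd (U i j)))"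
  define p1 where "p1 = (\<lambda>i (j::int). (1 / dx i) *\<^sub>R (M1 *v \<phi> i (j + 1) - M1 *v \<phi> i j))"
  define p2 where "p2 = (\<lambda>i (j::int). (1 / dx i) *\<^sub>R (M2 *v \<phi> i (j + 1) - M2 *v \<phi> i j))"
  have q1: "((\<lambda>i. q1 i j) \<longlongrightarrow> fst w) G" and q2: "((\<lambda>i. q2 i j) \<longlongrightarrow> snd w) G" for j
    unfolding q1_def q2_def
    using quotient_linear[OF bounded_linear_fst w] quotient_linear[OF bounded_linear_snd w] by auto
  have flow: "((\<lambda>i. relax_flow K R \<epsilon> (S (U i j)) (dt i)) \<longlongrightarrow> S v) G" for j
    by (rule relax_flow_tendsto[OF \<epsilon> dt U]) (use ev in \<open>auto elim: eventually_mono\<close>)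
  have "\<forall>\<^sub>F i in G. 0 < dt i \<and> S (U i (j + 1)) \<in> K \<and> S (U i j) \<in> K" for j
    using ev by (auto elim: eventually_mono)
  then have \<phi>: "((\<lambda>i. (1 / dx i) *\<^sub>R (\<phi> i (j + 1) - \<phi> i j)) \<longlongrightarrow> Df (S v) (S w)) G" for j
    unfolding \<phi>_def by (intro quotient_f[OF v flow flow] relax_flow_quotient[OF \<epsilon> dt U U _ w])
  have p1: "((\<lambda>i. p1 i j) \<longlongrightarrow> M1 *v Df (S v) (S w)) G" for j
    unfolding p1_def using \<phi> by (rule quotient_linear[OF matrix_vector_mul_bounded_linear])
  have p2: "((\<lambda>i. p2 i j) \<longlongrightarrow> M2 *v Df (S v) (S w)) G" for j
    unfolding p2_def using \<phi> by (rule quotient_linear[OF matrix_vector_mul_bounded_linear])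
  have E: "((\<lambda>i. (?E i - 1) / dt i) \<longlongrightarrow> - (1 / \<epsilon>)) G"
    using ev by (intro exp_quotient \<epsilon> dt) (auto elim: eventually_mono)
  \<comment> \<open>\<open>X\<close> and \<open>Y\<close> are the increments of the two components divided by the time step.\<close>
  define X where "X = (\<lambda>i. - ((sr * sl / (sr - sl)) *\<^sub>R (q1 i 0 - q1 i (-1))
      - (1 / (sr - sl)) *\<^sub>R (sl *\<^sub>R p1 i 0 - sr *\<^sub>R p1 i (-1))))"
  define Y where "Y = (\<lambda>i. - ((?E i * (sr * sl / (sr - sl))) *\<^sub>R (q2 i 0 - q2 i (-1))
      + (\<epsilon> * ((?E i - 1) / dt i) / (sr - sl)) *\<^sub>R (sl *\<^sub>R p2 i 0 - sr *\<^sub>R p2 i (-1)))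
      - ((?E i - 1) / dt i) *\<^sub>R (Q (fst (U i 0) + dt i *\<^sub>R X i) - snd (U i 0)))"
  have "(X \<longlongrightarrow> - ((sr * sl / (sr - sl)) *\<^sub>R (fst w - fst w)
      - (1 / (sr - sl)) *\<^sub>R (sl *\<^sub>R (M1 *v Df (S v) (S w)) - sr *\<^sub>R (M1 *v Df (S v) (S w))))) G"
    unfolding X_def by (intro tendsto_intros q1 p1)
  then have X: "(X \<longlongrightarrow> - (M1 *v Df (S v) (S w))) G"
    using wave_speeds_cancel[of "M1 *v Df (S v) (S w)"] by simp
  have "((\<lambda>i. fst (U i 0) + dt i *\<^sub>R X i) \<longlongrightarrow> fst v + 0 *\<^sub>R (- (M1 *v Df (S v) (S w)))) G"
    by (intro tendsto_intros U dt X)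
  then have V: "((\<lambda>i. fst (U i 0) + dt i *\<^sub>R X i) \<longlongrightarrow> fst v) G" by simp
  let ?c = "\<epsilon> * (- (1 / \<epsilon>)) / (sr - sl)" and ?x = "M2 *v Df (S v) (S w)"
  have "(Y \<longlongrightarrow> - ((exp (- 0 / \<epsilon>) * (sr * sl / (sr - sl))) *\<^sub>R (snd w - snd w)
      + ?c *\<^sub>R (sl *\<^sub>R ?x - sr *\<^sub>R ?x)) - (- (1 / \<epsilon>)) *\<^sub>R (Q (fst v) - snd v)) G"
    unfolding Y_def using \<epsilon> speeds by (intro tendsto_intros q2 p2 E dt tendsto_Q V U) auto
  note Y_lim = this
  have coefficient: "?c *\<^sub>R (sl *\<^sub>R ?x - sr *\<^sub>R ?x) = ?x"
  proof -
    have "?c = - 1 * (1 / (sr - sl))" using \<epsilon> by simp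
    then show ?thesis
      by (simp only: scaleR_scaleR[symmetric] wave_speeds_cancel) simp
  qed
  have Y: "(Y \<longlongrightarrow> (1 / \<epsilon>) *\<^sub>R (Q (fst v) - snd v) - ?x) G"
    using Y_lim unfolding coefficient by (simp add: algebra_simps)
  have XY: "((\<lambda>i. (X i, Y i)) \<longlongrightarrow> (- (M1 *v Df (S v) (S w)),
      (1 / \<epsilon>) *\<^sub>R (Q (fst v) - snd v) - M2 *v Df (S v) (S w))) G"
    by (intro tendsto_Pair X Y)
  have source: "M2 *v R (S v) = Q (fst v) - snd v"
    using R2 v by (simp add: state_conserved_relaxed)
  have "\<forall>\<^sub>F i in G. (X i, Y i) =
      (1 / dt i) *\<^sub>R (ar_step K f R Q M1 M2 sl sr \<epsilon> (dt i) (dx i) (U i) 0 - U i 0)"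
    using ev
  proof eventually_elim
    case (elim i)
    let ?F1 = "ar_flux1 K f R M1 M2 sl sr \<epsilon> (dt i)" and ?F2 = "ar_flux2 K f R M1 M2 sl sr \<epsilon> (dt i)"
    have flux1: "(1 / dx i) *\<^sub>R (?F1 (U i 0) (U i 1) - ?F1 (U i (-1)) (U i 0)) = - X i"
      unfolding X_def q1_def p1_def ar_flux1_def Let_def \<phi>_def
      by (simp only: flux_balance_quotients add_0_left add.left_inverse minus_minus)
    have flux2: "(1 / dx i) *\<^sub>R (?F2 (U i 0) (U i 1) - ?F2 (U i (-1)) (U i 0)) =
        (?E i * (sr * sl / (sr - sl))) *\<^sub>R (q2 i 0 - q2 i (-1))
        + (\<epsilon> * ((?E i - 1) / dt i) / (sr - sl)) *\<^sub>R (sl *\<^sub>R p2 i 0 - sr *\<^sub>R p2 i (-1))"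
    proof -
      have "?F2 a b = (?E i * (sr * sl / (sr - sl))) *\<^sub>R (snd b - snd a)
          - (- (\<epsilon> * ((?E i - 1) / dt i) / (sr - sl))) *\<^sub>R
            (sl *\<^sub>R (M2 *v f (relax_flow K R \<epsilon> (S b) (dt i)))
              - sr *\<^sub>R (M2 *v f (relax_flow K R \<epsilon> (S a) (dt i))))" for a b
        by (simp add: ar_flux2_def)
      then show ?thesis
        unfolding q2_def p2_def \<phi>_def
        by (simp only: flux_balance_quotients add_0_left add.left_inverse) simp
    qed
    have scale: "(dt i / dx i) *\<^sub>R z = dt i *\<^sub>R ((1 / dx i) *\<^sub>R z)" for z :: "real^'l"
      by simp
    have V: "fst (ar_step K f R Q M1 M2 sl sr \<epsilon> (dt i) (dx i) (U i) 0) = fst (U i 0) + dt i *\<^sub>R X i"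
      unfolding ar_step_def Let_def fst_conv scale using flux1 by simp
    have Z: "snd (ar_step K f R Q M1 M2 sl sr \<epsilon> (dt i) (dx i) (U i) 0) = snd (U i 0) + dt i *\<^sub>R Y i"
    proof -
      have e: "dt i * ((?E i - 1) / dt i) = ?E i - 1" using elim by simp
      have "snd (ar_step K f R Q M1 M2 sl sr \<epsilon> (dt i) (dx i) (U i) 0) =
          snd (U i 0) - (dt i / dx i) *\<^sub>R (?F2 (U i 0) (U i 1) - ?F2 (U i (-1)) (U i 0))
          - (?E i - 1) *\<^sub>R (Q (fst (U i 0) + dt i *\<^sub>R X i) - snd (U i 0))"
        unfolding V[symmetric] by (simp add: ar_step_def Let_def)
      also have "\<dots> = snd (U i 0) + dt i *\<^sub>R Y i"
      proof -
        have regroup: "z - d *\<^sub>R a - c *\<^sub>R b = z + d *\<^sub>R (- a - r *\<^sub>R b)"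
          if "d * r = c" for z a b :: "real^'m" and c d r :: real
          using that by (auto simp add: algebra_simps)
        show ?thesis
          unfolding scale flux2 Y_def by (rule regroup[OF e])
      qed
      finally show ?thesis .
    qed
    show ?case
      using elim by (simp add: prod_eq_iff V Z)
  qed
  from Lim_transform_eventually[OF XY this]
  show "((\<lambda>i. (1 / dt i) *\<^sub>R (ar_step K f R Q M1 M2 sl sr \<epsilon> (dt i) (dx i) (U i) 0 - U i 0)) \<longlongrightarrow>
      (0, (1 / \<epsilon>) *\<^sub>R (M2 *v R (S v))) - (M1 *v Df (S v) (S w), M2 *v Df (S v) (S w))) G"
    by (simp add: source)
qed

text \<open>The equilibrium flux is \<open>f\<close> composed with the equilibrium map \<open>V \<mapsto> (V, Q V)\<close>, so its derivative
and its difference quotients come from those of \<open>f\<close> and \<open>Q\<close>.\<close>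

lemma equilibrium_hll_consistent:
  "fv_consistent ((\<lambda>W. M1 *v W) ` K) (f_eq f Q M1 M2) (\<lambda>_. 0) \<mu>
    (\<lambda>_. hll_flux (f_eq f Q M1 M2) sl sr) (hll_step (f_eq f Q M1 M2) sl sr)"
proof (rule hll_consistent[where g' = "\<lambda>V w. M1 *v Df (S (V, Q V)) (S (w, DQ V w))"])
  show "convex ((\<lambda>W. M1 *v W) ` K)"
    using K by (intro convex_linear_image) auto
  show "sl \<noteq> sr" by (rule speeds)
next
  fix V assume "V \<in> (\<lambda>W. M1 *v W) ` K"
  then have V: "S (V, Q V) \<in> K" using equilibrium by auto
  have "((\<lambda>V. S (V, Q V)) has_derivative (\<lambda>w. S (w, DQ V w))) (at V)"
    by (intro bounded_linear.has_derivative[OF bounded_linear_state] has_derivative_Pair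
        has_derivative_ident has_derivative_Q)
  from has_derivative_compose[OF this has_derivative_f[OF V]]
  show "(f_eq f Q M1 M2 has_derivative (\<lambda>w. M1 *v Df (S (V, Q V)) (S (w, DQ V w)))) (at V)"
    unfolding f_eq_def by (rule bounded_linear.has_derivative[OF matrix_vector_mul_bounded_linear])
next
  fix G :: "((real \<times> real) \<times> (real \<times> real)) filter" and h :: "_ \<Rightarrow> real" and b c V w
  assume "V \<in> (\<lambda>W. M1 *v W) ` K" and b: "(b \<longlongrightarrow> V) G" and c: "(c \<longlongrightarrow> V) G"
    and q: "((\<lambda>i. (1 / h i) *\<^sub>R (b i - c i)) \<longlongrightarrow> w) G"
  then have V: "S (V, Q V) \<in> K" using equilibrium by auto
  have "((\<lambda>i. (1 / h i) *\<^sub>R ((b i, Q (b i)) - (c i, Q (c i)))) \<longlongrightarrow> (w, DQ V w)) G"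
    using tendsto_Pair[OF q quotient_Q[OF b c q]] by simp
  then have "((\<lambda>i. (1 / h i) *\<^sub>R (S (b i, Q (b i)) - S (c i, Q (c i)))) \<longlongrightarrow> S (w, DQ V w)) G"
    by (rule quotient_linear[OF bounded_linear_state])
  then have "((\<lambda>i. (1 / h i) *\<^sub>R (f (S (b i, Q (b i))) - f (S (c i, Q (c i))))) \<longlongrightarrow>
      Df (S (V, Q V)) (S (w, DQ V w))) G"
    by (intro quotient_f V bounded_linear.tendsto[OF bounded_linear_state] tendsto_Pair tendsto_Q b c)
  then show "((\<lambda>i. (1 / h i) *\<^sub>R (f_eq f Q M1 M2 (b i) - f_eq f Q M1 M2 (c i))) \<longlongrightarrow>
      M1 *v Df (S (V, Q V)) (S (w, DQ V w))) G"
    unfolding f_eq_def by (rule quotient_linear[OF matrix_vector_mul_bounded_linear])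
qed

text \<open>For a fixed positive time step the flow reaches equilibrium as \<open>\<epsilon>\<close> vanishes, because
\<open>exp (- dt / \<epsilon>)\<close> tends to \<open>0\<close>. The first numerical flux then only sees equilibrium states and is
the HLL flux of the equilibrium system.\<close>

lemma stiff_limit:
  assumes dt: "0 < dt" and U: "\<forall>j. S (U j) \<in> K"
  shows "((\<lambda>\<epsilon>. fst (ar_step K f R Q M1 M2 sl sr \<epsilon> dt dx U j)) \<longlongrightarrow>
    hll_step (f_eq f Q M1 M2) sl sr dt dx (\<lambda>i. fst (U i)) j) (at_right 0)"
proof -
  have exp0: "((\<lambda>\<epsilon>. exp (- dt / \<epsilon>)) \<longlongrightarrow> 0) (at_right 0)"
  proof (rule filterlim_compose[OF exp_at_bot])
    have "filterlim (\<lambda>\<epsilon>. dt * inverse \<epsilon>) at_top (at_right 0)"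
      by (intro filterlim_tendsto_pos_mult_at_top[OF tendsto_const dt] filterlim_inverse_at_top_right)
    then show "filterlim (\<lambda>\<epsilon>. - dt / \<epsilon>) at_bot (at_right 0)"
      by (simp add: filterlim_uminus_at_bot divide_inverse)
  qed
  have flow: "((\<lambda>\<epsilon>. relax_flow K R \<epsilon> (S (U a)) dt) \<longlongrightarrow> S (fst (U a), Q (fst (U a)))) (at_right 0)" for a
  proof (rule Lim_transform_eventually)
    let ?p = "S (fst (U a), Q (fst (U a)))"
    have "((\<lambda>\<epsilon>. ?p + exp (- dt / \<epsilon>) *\<^sub>R (S (U a) - ?p)) \<longlongrightarrow> ?p + 0 *\<^sub>R (S (U a) - ?p)) (at_right 0)"
      by (intro tendsto_intros exp0)
    then show "((\<lambda>\<epsilon>. ?p + exp (- dt / \<epsilon>) *\<^sub>R (S (U a) - ?p)) \<longlongrightarrow> ?p) (at_right 0)"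
      by simp
    show "\<forall>\<^sub>F \<epsilon> in at_right 0. ?p + exp (- dt / \<epsilon>) *\<^sub>R (S (U a) - ?p) = relax_flow K R \<epsilon> (S (U a)) dt"
      using U dt by (auto simp: eventually_at_filter relax_flow_state)
  qed
  have flux: "((\<lambda>\<epsilon>. ar_flux1 K f R M1 M2 sl sr \<epsilon> dt (U a) (U b)) \<longlongrightarrow>
      hll_flux (f_eq f Q M1 M2) sl sr (fst (U a)) (fst (U b))) (at_right 0)" for a b
  proof -
    have M1f: "((\<lambda>\<epsilon>. M1 *v f (relax_flow K R \<epsilon> (S (U a)) dt)) \<longlongrightarrow> f_eq f Q M1 M2 (fst (U a))) (at_right 0)" for a
      unfolding f_eq_def using U
      by (intro bounded_linear.tendsto[OF matrix_vector_mul_bounded_linear] tendsto_f flow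
          equilibrium_in_K) auto
    have "((\<lambda>\<epsilon>. ar_flux1 K f R M1 M2 sl sr \<epsilon> dt (U a) (U b)) \<longlongrightarrow>
        (sr * sl / (sr - sl)) *\<^sub>R (fst (U b) - fst (U a))
         - (1 / (sr - sl)) *\<^sub>R (sl *\<^sub>R f_eq f Q M1 M2 (fst (U b)) - sr *\<^sub>R f_eq f Q M1 M2 (fst (U a)))) (at_right 0)"
      unfolding ar_flux1_def Let_def by (intro tendsto_intros M1f)
    then show ?thesis
      by (simp add: hll_flux_def algebra_simps)
  qed
  show ?thesis
    unfolding ar_step_def hll_step_def Let_def fst_conv by (intro tendsto_intros flux)
qed

end

section \<open>The asymptotic-preserving property\<close>

theorem proposition3:
  fixes K :: "(real^'n) set"
    and f R :: "real^'n \<Rightarrow> real^'n"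
    and Q :: "real^'k \<Rightarrow> real^'m"
    and M1 :: "real^'n^'k"
    and M2 :: "real^'n^'m"
    and sl sr dt dx :: real
    and U :: "int \<Rightarrow> (real^'k) \<times> (real^'m)"
  assumes "CARD('n) = CARD('k) + CARD('m)"
    and "rank M1 = CARD('k)" and "rank M2 = CARD('m)"
    and "invertible (vstack M1 M2)"
    and "convex K"
    and "smooth_near K f" and "hyperbolic_on K f"
    and "smooth_near UNIV Q"
    and "\<forall>W\<in>K. M1 *v R W = 0"
    and "\<forall>W\<in>K. M2 *v R W = Q (M1 *v W) - M2 *v W"
    and "\<forall>W\<in>K. frechet_derivative (\<lambda>W'. M2 *v f W') (at W) (R W) = 0"
    and "\<forall>W\<in>K. state M1 M2 (M1 *v W, Q (M1 *v W)) \<in> K"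
    and "sl < 0" and "0 < sr"
    and "0 < dt" and "0 < dx"
    and CFL: "dt / dx * max \<bar>sl\<bar> \<bar>sr\<bar> \<le> 1 / 2"
    and data: "\<forall>j. state M1 M2 (U j) \<in> K"
  shows
    "(\<forall>\<epsilon>>0. fv_consistent {u. state M1 M2 u \<in> K}
        (\<lambda>u. (M1 *v f (state M1 M2 u), M2 *v f (state M1 M2 u)))
        (\<lambda>u. (0, (1 / \<epsilon>) *\<^sub>R (M2 *v R (state M1 M2 u))))
        (max \<bar>sl\<bar> \<bar>sr\<bar>)
        (ar_flux K f R M1 M2 sl sr \<epsilon>)
        (ar_step K f R Q M1 M2 sl sr \<epsilon>))
     \<and> (\<forall>j. ((\<lambda>\<epsilon>. fst (ar_step K f R Q M1 M2 sl sr \<epsilon> dt dx U j))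
              \<longlongrightarrow> hll_step (f_eq f Q M1 M2) sl sr dt dx (\<lambda>i. fst (U i)) j) (at_right 0))
     \<and> fv_consistent ((\<lambda>W. M1 *v W) ` K) (f_eq f Q M1 M2) (\<lambda>_. 0) (max \<bar>sl\<bar> \<bar>sr\<bar>)
        (\<lambda>_. hll_flux (f_eq f Q M1 M2) sl sr) (hll_step (f_eq f Q M1 M2) sl sr)
     \<and> hll_stable ((\<lambda>W. M1 *v W) ` K) (f_eq f Q M1 M2) sl sr dt dx"
proof -
  interpret relaxation_scheme K f R Q M1 M2 sl sr
    using assms by unfold_locales auto
  show ?thesis
    using ar_consistent stiff_limit[OF \<open>0 < dt\<close> data] equilibrium_hll_consistent
      hll_stable_of_CFL[OF \<open>sl < 0\<close> \<open>0 < sr\<close> \<open>0 < dt\<close> \<open>0 < dx\<close> CFL]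
    by blast
qed

end
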